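(* Let $n\ge 1$, $n<p<\infty$, $\frac1p+\frac1q=1$, and let $\rho$ be a signed Borel measure on $\mathbb{R}^n$ with compact support, $\rho(\mathbb{R}^n)=0$, and $\int_{\mathbb{R}^n}y\,d\rho(y)\ne0$. Then $$\sup_{\|Du\|_p\le 1}\left|\int_{\mathbb{R}^n}u(y)\,d\rho(y)\right|=\inf\left\{\left(\int_{\mathbb{R}^n}|F(y)|^q\,dy\right)^{1/q}:\ F\in L^q(\mathbb{R}^n;\mathbb{R}^n),\ \mathrm{div}\,F=\rho\text{ in }\mathbb{R}^n\right\},$$ where the supremum is over $u\in\mathcal{D}^{1,p}(\mathbb{R}^n)$ with $\|Du\|_p\le1$.
   Context: $\mathcal{D}^{1,p}(\mathbb{R}^n)$ is the space of $u\in L^1_{\rm loc}(\mathbb{R}^n)$ whose weak partial derivatives $u_{x_i}$, $i=1,\dots,n$, all belong to $L^p(\mathbb{R}^n)$. Since $p>n$, each $u$ is identified with its $(1-n/p)$-Hölder continuous representative. $\|Du\|_p:=\left(\int_{\mathbb{R}^n}|Du|^p\,dx\right)^{1/p}$. For $F\in L^q(\mathbb{R}^n;\mathbb{R}^n)$, $\mathrm{div}\,F=\rho$ in $\mathbb{R}^n$ means that $$-\int_{\mathbb{R}^n}Dv\cdot F\,dy=\int_{\mathbb{R}^n}v\,d\rho\quad\text{for all }v\in\mathcal{D}^{1,p}(\mathbb{R}^n).$$ *)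

theory Defs
  imports "HOL-Analysis.Analysis"
begin

section \<open>Signed Borel measures\<close>

text \<open>
  A signed measure is a countably additive set function on the Borel sets; its values on
  other sets are irrelevant. Values are real: a signed measure with values in the extended
  reals and finite total mass is automatically finite on every Borel set.
\<close>

definition signed_borel_measure :: "('a::topological_space set \<Rightarrow> real) \<Rightarrow> bool" where
  "signed_borel_measure \<rho> \<longleftrightarrow>
     \<rho> {} = 0 \<and>
     (\<forall>A :: nat \<Rightarrow> 'a set. range A \<subseteq> sets borel \<longrightarrow> disjoint_family A \<longrightarrow>
        (\<lambda>i. \<rho> (A i)) sums \<rho> (\<Union>i. A i))"

text \<open>The two parts of the Jordan decomposition. Note that \<open>ennreal\<close> truncates at \<open>0\<close>,
  harmlessly, since \<open>B = {}\<close> contributes \<open>0\<close> to the supremum.\<close>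

definition pos_variation :: "('a::topological_space set \<Rightarrow> real) \<Rightarrow> 'a measure" where
  "pos_variation \<rho> =
     measure_of UNIV (sets borel) (\<lambda>A. SUP B \<in> {B \<in> sets borel. B \<subseteq> A}. ennreal (\<rho> B))"

definition neg_variation :: "('a::topological_space set \<Rightarrow> real) \<Rightarrow> 'a measure" where
  "neg_variation \<rho> = pos_variation (\<lambda>A. - \<rho> A)"

definition signed_integral ::
  "('a::topological_space set \<Rightarrow> real) \<Rightarrow> ('a \<Rightarrow> 'b::{banach, second_countable_topology}) \<Rightarrow> 'b"
  where
  "signed_integral \<rho> f = (\<integral>x. f x \<partial>pos_variation \<rho>) - (\<integral>x. f x \<partial>neg_variation \<rho>)"

text \<open>The complement of the union of all open sets on which \<open>|\<rho>|\<close> vanishes.\<close>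

definition signed_support :: "('a::topological_space set \<Rightarrow> real) \<Rightarrow> 'a set" where
  "signed_support \<rho> = - \<Union>{U. open U \<and> (\<forall>B \<in> sets borel. B \<subseteq> U \<longrightarrow> \<rho> B = 0)}"


section \<open>Lebesgue spaces\<close>

text \<open>
  Elements of \<open>L\<^sup>p\<close> are represented by Borel functions; every a.e.-class of Lebesgue measurable
  functions contains one. The exponent is meant to satisfy \<open>1 \<le> p < \<infinity>\<close>.
\<close>

definition Lp_space :: "real \<Rightarrow> ('a::euclidean_space \<Rightarrow> 'b::euclidean_space) set" where
  "Lp_space p = {f \<in> borel_measurable lborel. integrable lborel (\<lambda>x. norm (f x) powr p)}"

definition Lp_norm :: "real \<Rightarrow> ('a::euclidean_space \<Rightarrow> 'b::euclidean_space) \<Rightarrow> real" where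
  "Lp_norm p f = (\<integral>x. norm (f x) powr p \<partial>lborel) powr (1 / p)"

definition locally_integrable :: "('a::euclidean_space \<Rightarrow> real) \<Rightarrow> bool" where
  "locally_integrable f \<longleftrightarrow> (\<forall>K. compact K \<longrightarrow> set_integrable lborel K f)"


section \<open>Weak derivatives\<close>

definition partial_deriv :: "'n::finite \<Rightarrow> (real ^ 'n \<Rightarrow> real) \<Rightarrow> real ^ 'n \<Rightarrow> real" where
  "partial_deriv i f x = frechet_derivative f (at x) (axis i 1)"

primrec C_k :: "nat \<Rightarrow> (real ^ 'n::finite \<Rightarrow> real) \<Rightarrow> bool" where
  "C_k 0 f \<longleftrightarrow> continuous_on UNIV f"
| "C_k (Suc k) f \<longleftrightarrow> (\<forall>x. f differentiable (at x)) \<and> (\<forall>i. C_k k (partial_deriv i f))"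

definition test_functions :: "(real ^ 'n::finite \<Rightarrow> real) set" where
  "test_functions = {\<phi>. (\<forall>k. C_k k \<phi>) \<and> compact (closure {x. \<phi> x \<noteq> 0})}"

definition weak_partial_deriv ::
  "'n::finite \<Rightarrow> (real ^ 'n \<Rightarrow> real) \<Rightarrow> (real ^ 'n \<Rightarrow> real) \<Rightarrow> bool" where
  "weak_partial_deriv i u g \<longleftrightarrow>
     locally_integrable g \<and>
     (\<forall>\<phi> \<in> test_functions.
        (\<integral>x. u x * partial_deriv i \<phi> x \<partial>lborel) = - (\<integral>x. g x * \<phi> x \<partial>lborel))"

text \<open>\<open>G\<close> represents \<open>Du\<close>, all of whose components lie in \<open>L\<^sup>p\<close>. Weak derivatives, and hence
  such a \<open>G\<close>, are unique only up to null sets, so this is a relation.\<close>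

definition weak_gradient ::
  "real \<Rightarrow> (real ^ 'n::finite \<Rightarrow> real) \<Rightarrow> (real ^ 'n \<Rightarrow> real ^ 'n) \<Rightarrow> bool" where
  "weak_gradient p u G \<longleftrightarrow>
     (\<forall>i. weak_partial_deriv i u (\<lambda>x. G x $ i) \<and> (\<lambda>x. G x $ i) \<in> Lp_space p)"


section \<open>The homogeneous Sobolev space and the divergence equation\<close>

definition hoelder_continuous :: "real \<Rightarrow> ('a::metric_space \<Rightarrow> 'b::metric_space) \<Rightarrow> bool" where
  "hoelder_continuous \<alpha> u \<longleftrightarrow> (\<exists>C. \<forall>x y. dist (u x) (u y) \<le> C * dist x y powr \<alpha>)"

text \<open>For \<open>p > n\<close> every class in this space has exactly one Hoelder continuous representative
  with exponent \<open>1 - n / p\<close> (Morrey); the elements below are these representatives.\<close>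

definition D1p :: "real \<Rightarrow> (real ^ 'n::finite \<Rightarrow> real) set" where
  "D1p p = {u. locally_integrable u \<and> (\<exists>G. weak_gradient p u G) \<and>
               hoelder_continuous (1 - real CARD('n) / p) u}"

definition div_eq ::
  "real \<Rightarrow> (real ^ 'n::finite \<Rightarrow> real ^ 'n) \<Rightarrow> ((real ^ 'n) set \<Rightarrow> real) \<Rightarrow> bool" where
  "div_eq p F \<rho> \<longleftrightarrow>
     (\<forall>v \<in> D1p p. \<forall>G. weak_gradient p v G \<longrightarrow>
        - (\<integral>y. G y \<bullet> F y \<partial>lborel) = signed_integral \<rho> v)"

end

theory Submission
  imports Defs
begin

text \<open>
  One inequality is Hoelder's. For the other, only a finite supremum \<open>K\<close> matters; then
  \<open>Du \<mapsto> - \<integral> u d\<rho>\<close> is a well-defined linear functional of norm at most \<open>K\<close> on the subspace of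
  gradients in \<open>L\<^sup>p\<close>, and a divergence field is a function in \<open>L\<^sup>q\<close> of norm at most \<open>K\<close> representing
  it. Instead of extending the functional (Hahn-Banach) and invoking the duality of \<open>L\<^sup>p\<close> and
  \<open>L\<^sup>q\<close>, one minimises \<open>(\<integral>|G|\<^sup>p) / p - l G\<close> over the subspace.
\<close>

section \<open>Convexity of powers of the norm\<close>

text \<open>The gradients are not shown to form a closed subspace, so the limit \<open>g\<close> of
  a minimising sequence is not known to be a gradient. Hence \<open>l\<close> is never evaluated at
  \<open>g\<close>: minimality is used only along a sequence \<open>G n\<close> inside the subspace,
  and both the Euler-Lagrange equation and the norm bound are limits of statements about
  \<open>G n\<close>. Near-minimality within \<open>(1/4)^n\<close> is tested with variations of
  size \<open>(1/2)^n\<close>, so the error still vanishes after division by the step. Convergence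
  rests on a pointwise inequality with an arbitrarily small \<open>\<epsilon>\<close>. Integrated,
  it bounds the distance of two fields by a small multiple of their energies plus their convexity
  defect, and it treats all \<open>p > 1\<close> alike. A finite supremum makes the functional well
  defined: if \<open>u\<close> has gradient \<open>0\<close>, all multiples of \<open>u\<close> are
  admissible, so their integrals stay bounded only if the integral of \<open>u\<close> is
  \<open>0\<close>. Linearity in \<open>u\<close> requires continuous functions to be integrable
  against both variations of \<open>\<rho>\<close>; this is why finiteness of the variations and
  their concentration on the compact support are established.\<close>

lemma powr_midpoint_strict:
  fixes m d p :: real
  assumes "p > 1" "0 < d" "d \<le> m"
  shows "2 * m powr p < (m + d) powr p + (m - d) powr p"
proof -
  let ?h = "\<lambda>x. (m + x) powr p + (m - x) powr p"
  \<comment> \<open>If \<open>d = m\<close>, the base \<open>m - x\<close> vanishes at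
    \<open>x = d\<close>, where the derivative rule for \<open>powr\<close> does not apply; so the
    derivative is taken on the open interval and only continuity is used at its ends.\<close>
  have "?h 0 < ?h d"
  proof (rule DERIV_pos_imp_increasing_open[OF assms(2)])
    fix x :: real
    assume x: "0 < x" "x < d"
    have "DERIV ?h x :> p * (m + x) powr (p - 1) - p * (m - x) powr (p - 1)"
      using x assms by (auto intro!: derivative_eq_intros simp: powr_diff field_simps)
    moreover have "(m - x) powr (p - 1) < (m + x) powr (p - 1)"
      using x assms by (intro powr_less_mono2) auto
    ultimately show "\<exists>y. DERIV ?h x :> y \<and> y > 0"
      using assms by fastforce
  next
    show "continuous_on {0..d} ?h"
      using assms by (intro continuous_on_add continuous_on_powr' continuous_intros) auto
  qed
  then show ?thesis by simp
qed

text \<open>If the norms agree, equality in the triangle inequality would make the vectors parallel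
  and hence equal, so the midpoint is strictly shorter. If they differ, strict convexity of the
  scalar power suffices.\<close>

lemma norm_midpoint_powr_less:
  fixes a b :: "'a::real_inner"
  assumes "p > 1" "a \<noteq> b"
  shows "norm ((a + b) /\<^sub>R 2) powr p < (norm a powr p + norm b powr p) / 2"
proof -
  have tri: "norm ((a + b) /\<^sub>R 2) \<le> (norm a + norm b) / 2"
    using norm_triangle_ineq[of a b] by simp
  show ?thesis
  proof (cases "norm a = norm b")
    case True
    have "norm (a + b) \<noteq> norm a + norm b"
    proof
      assume "norm (a + b) = norm a + norm b"
      then have "norm a *\<^sub>R b = norm a *\<^sub>R a"
        unfolding norm_triangle_eq using True by simp
      then show False using assms True by auto
    qed
    then have "norm ((a + b) /\<^sub>R 2) < (norm a + norm b) / 2"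
      using norm_triangle_ineq[of a b] by simp
    then have "norm ((a + b) /\<^sub>R 2) powr p < ((norm a + norm b) / 2) powr p"
      using assms by (intro powr_less_mono2) auto
    then show ?thesis using True by simp
  next
    case False
    define d where "d = \<bar>norm a - norm b\<bar> / 2"
    define m where "m = (norm a + norm b) / 2"
    have d: "0 < d" "d \<le> m"
      using False norm_ge_zero[of a] norm_ge_zero[of b]
      unfolding d_def m_def by (auto simp del: norm_ge_zero)
    have "2 * m powr p < (m + d) powr p + (m - d) powr p"
      by (rule powr_midpoint_strict[OF assms(1) d])
    also have "\<dots> = norm a powr p + norm b powr p"
    proof (cases "norm a \<le> norm b")
      case True
      then have "m + d = norm b" "m - d = norm a" by (auto simp: d_def m_def field_simps)
      then show ?thesis by simp
    next
      case False
      then have "m + d = norm a" "m - d = norm b" by (auto simp: d_def m_def field_simps)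
      then show ?thesis by simp
    qed
    finally have "m powr p < (norm a powr p + norm b powr p) / 2" by simp
    moreover have "norm ((a + b) /\<^sub>R 2) powr p \<le> m powr p"
      using tri assms unfolding m_def by (intro powr_mono2) auto
    ultimately show ?thesis by linarith
  qed
qed

lemma norm_midpoint_powr_le:
  fixes a b :: "'a::real_inner"
  assumes "p > 1"
  shows "norm ((a + b) /\<^sub>R 2) powr p \<le> (norm a powr p + norm b powr p) / 2"
proof (cases "a = b")
  case True
  then show ?thesis by (simp flip: scaleR_2)
qed (use norm_midpoint_powr_less[OF assms, of a b] in simp)

lemma norm_add_powr_le:
  fixes a b :: "'a::real_inner"
  assumes "p > 1"
  shows "norm (a + b) powr p \<le> 2 powr p * (norm a powr p + norm b powr p)"
proof -
  have "norm (a + b) powr p = 2 powr p * norm ((a + b) /\<^sub>R 2) powr p"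
    by (simp add: powr_mult[symmetric])
  also have "\<dots> \<le> 2 powr p * (norm a powr p + norm b powr p)"
  proof (intro mult_left_mono)
    have "(norm a powr p + norm b powr p) / 2 \<le> norm a powr p + norm b powr p"
      by simp
    then show "norm ((a + b) /\<^sub>R 2) powr p \<le> norm a powr p + norm b powr p"
      using norm_midpoint_powr_le[OF assms, of a b] by linarith
  qed simp
  finally show ?thesis .
qed

text \<open>Compactness and strict convexity give a modulus of convexity on the set where
  \<open>|a| + |b| = 1\<close> and \<open>|a - b| \<ge> e\<close>; homogeneity extends it to all vectors.\<close>

lemma uniform_convexity_powr:
  fixes p \<epsilon> :: real
  assumes p: "p > 1" and \<epsilon>: "\<epsilon> > 0"
  obtains C where "C > 0"
    "\<And>a b :: 'a::euclidean_space. norm (a - b) powr p \<le> \<epsilon> * (norm a powr p + norm b powr p)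
        + C * ((norm a powr p + norm b powr p) / 2 - norm ((a + b) /\<^sub>R 2) powr p)"
proof -
  \<comment> \<open>Chosen so that \<open>(e * s) powr p\<close>, with
    \<open>s = norm a + norm b\<close>, is at most
    \<open>\<epsilon> * (norm a powr p + norm b powr p)\<close>; the factor \<open>2 powr p\<close>
    comes from \<open>norm_add_powr_le\<close>.\<close>
  define e where "e = (\<epsilon> / 2 powr p) powr (1 / p)"
  have e: "e > 0" using \<epsilon> by (simp add: e_def)
  have e_powr: "e powr p = \<epsilon> / 2 powr p"
    using \<epsilon> p by (simp add: e_def powr_powr)
  define \<phi> where "\<phi> = (\<lambda>(a :: 'a, b :: 'a). (norm a powr p + norm b powr p) / 2 - norm ((a + b) /\<^sub>R 2) powr p)"
  define S where "S = {(a :: 'a, b :: 'a). norm a + norm b = 1 \<and> e \<le> norm (a - b)}"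
  have \<phi>_nonneg: "\<phi> (a, b) \<ge> 0" for a b
    using norm_midpoint_powr_le[OF p, of a b] by (simp add: \<phi>_def)
  have "compact S"
  proof -
    have "S \<subseteq> cball 0 1 \<times> cball 0 1"
      by (auto simp: S_def) (smt (verit) norm_ge_zero)+
    then have "bounded S" by (rule bounded_subset[rotated]) (intro bounded_Times bounded_cball)
    moreover have "closed {x :: 'a \<times> 'a. norm (fst x) + norm (snd x) = 1}"
      by (intro closed_Collect_eq continuous_intros)
    moreover have "closed {x :: 'a \<times> 'a. e \<le> norm (fst x - snd x)}"
      by (intro closed_Collect_le continuous_intros)
    moreover have "S = {x. norm (fst x) + norm (snd x) = 1} \<inter> {x. e \<le> norm (fst x - snd x)}"
      by (auto simp: S_def)
    ultimately show ?thesis by (simp add: compact_eq_bounded_closed closed_Int)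
  qed
  have cont: "continuous_on S \<phi>"
    unfolding \<phi>_def case_prod_unfold using p
    by (intro continuous_on_powr' continuous_intros) auto
  \<comment> \<open>The minimum of the convexity defect on the compact set \<open>S\<close>; it is
    positive because \<open>e > 0\<close> keeps \<open>a\<close> and \<open>b\<close> apart. For
    empty \<open>S\<close> any value serves.\<close>
  obtain \<delta> where \<delta>: "\<delta> > 0" "\<And>x. x \<in> S \<Longrightarrow> \<delta> \<le> \<phi> x"
  proof (cases "S = {}")
    case True
    then show ?thesis using that[of 1] by auto
  next
    case False
    obtain x where x: "x \<in> S" "\<And>y. y \<in> S \<Longrightarrow> \<phi> x \<le> \<phi> y"
      using continuous_attains_inf[OF \<open>compact S\<close> False cont] by auto
    obtain a b where ab: "x = (a, b)" by force
    have "a \<noteq> b" using x(1) e by (auto simp: S_def ab)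
    then have "\<phi> x > 0"
      using norm_midpoint_powr_less[OF p, of a b] by (simp add: \<phi>_def ab)
    then show ?thesis using that x by blast
  qed
  show ?thesis
  proof (rule that[of "1 / \<delta>"])
    show "1 / \<delta> > 0" using \<delta> by simp
    fix a b :: 'a
    define s where "s = norm a + norm b"
    have s0: "s \<ge> 0" by (simp add: s_def)
    have sp: "s powr p \<le> 2 powr p * (norm a powr p + norm b powr p)"
      using norm_add_powr_le[OF p, of "norm a" "norm b"] by (simp add: s_def)
    have "norm (a - b) powr p \<le> \<epsilon> * (norm a powr p + norm b powr p) + 1 / \<delta> * \<phi> (a, b)"
    proof (cases "norm (a - b) < e * s")
      case True
      then have "norm (a - b) powr p \<le> (e * s) powr p"
        using p by (intro powr_mono2) auto
      also have "\<dots> = e powr p * s powr p" using e s0 by (simp add: powr_mult)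
      also have "\<dots> \<le> e powr p * (2 powr p * (norm a powr p + norm b powr p))"
        by (intro mult_left_mono sp) simp
      also have "\<dots> = \<epsilon> * (norm a powr p + norm b powr p)"
        by (simp add: e_powr)
      finally show ?thesis using \<phi>_nonneg[of a b] \<delta>(1)
        by (smt (verit) divide_nonneg_pos mult_nonneg_nonneg)
    next
      case False
      show ?thesis
      proof (cases "s = 0")
        case True
        then have "a = 0" "b = 0" by (auto simp: s_def add_nonneg_eq_0_iff)
        then show ?thesis by (simp add: \<phi>_def)
      next
        case s: False
        with s0 have s: "s > 0" by simp
        \<comment> \<open>The defect is homogeneous of degree \<open>p\<close>, so its lower bound
          \<open>\<delta>\<close> at the normalised pair gives
          \<open>s powr p \<le> \<phi> (a, b) / \<delta>\<close>, and
          \<open>norm (a - b) \<le> s\<close>.\<close>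
        have "(a /\<^sub>R s, b /\<^sub>R s) \<in> S"
        proof -
          have "norm (a /\<^sub>R s) + norm (b /\<^sub>R s) = 1"
          proof -
            have "norm (a /\<^sub>R s) + norm (b /\<^sub>R s) = (norm a + norm b) / s"
              using s by (simp add: divide_inverse algebra_simps)
            then show ?thesis using s by (simp add: s_def)
          qed
          moreover have "norm (a /\<^sub>R s - b /\<^sub>R s) = norm (a - b) / s"
            using s by (simp flip: scaleR_diff_right add: divide_inverse)
          moreover have "e \<le> norm (a - b) / s"
            using False s by (simp add: pos_le_divide_eq)
          ultimately show ?thesis unfolding S_def by simp
        qed
        then have "\<delta> \<le> \<phi> (a /\<^sub>R s, b /\<^sub>R s)" by (rule \<delta>(2))
        also have "\<dots> = \<phi> (a, b) / s powr p"
        proof -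
          have *: "norm (x /\<^sub>R s) powr p = norm x powr p / s powr p" for x :: 'a
            using s powr_divide[of "norm x" s p] by (simp add: divide_inverse_commute)
          have "(a /\<^sub>R s + b /\<^sub>R s) /\<^sub>R 2 = ((a + b) /\<^sub>R 2) /\<^sub>R s"
            by (simp add: scaleR_add_right)
          then show ?thesis
            unfolding \<phi>_def prod.case by (simp only: *) (simp add: add_divide_distrib diff_divide_distrib)
        qed
        finally have "s powr p \<le> 1 / \<delta> * \<phi> (a, b)"
          using s \<delta>(1) by (simp add: field_simps)
        moreover have "norm (a - b) powr p \<le> s powr p"
          using p norm_triangle_ineq4[of a b] by (intro powr_mono2) (auto simp: s_def)
        ultimately show ?thesis using \<epsilon> by (smt (verit) mult_nonneg_nonneg powr_ge_zero)
      qed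
    qed
    then show "norm (a - b) powr p \<le> \<epsilon> * (norm a powr p + norm b powr p)
        + 1 / \<delta> * ((norm a powr p + norm b powr p) / 2 - norm ((a + b) /\<^sub>R 2) powr p)"
      by (simp add: \<phi>_def)
  qed
qed

text \<open>The gradient of \<open>norm b powr p / p\<close>. For \<open>p < 2\<close> the scalar
  factor is singular at \<open>0\<close>, but the vector factor (and \<open>0 powr _ = 0\<close>)
  gives the right value \<open>0\<close> there.\<close>

definition duality_map :: "real \<Rightarrow> 'a::real_inner \<Rightarrow> 'a" where
  "duality_map p b = norm b powr (p - 2) *\<^sub>R b"

lemma norm_duality_map: "norm (duality_map p b) = norm b powr (p - 1)"
proof (cases "b = 0")
  case False
  then have "norm b powr (p - 1) = norm b powr (p - 2) * norm b powr 1"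
    by (subst powr_add[symmetric]) simp
  then show ?thesis by (simp add: duality_map_def)
qed (simp add: duality_map_def)

lemma duality_map_inner_self: "duality_map p b \<bullet> b = norm b powr p"
proof (cases "b = 0")
  case False
  then have "norm b powr p = norm b powr (p - 2) * norm b powr 2"
    by (subst powr_add[symmetric]) simp
  then show ?thesis using False by (simp add: duality_map_def dot_square_norm)
qed (simp add: duality_map_def)

text \<open>The tangent inequality of a convex function, obtained from Young's inequality with the
  conjugate exponent: \<open>(p - 1) * q = p\<close> turns the norm of the dual vector back into
  \<open>norm b powr p\<close>.\<close>

lemma norm_powr_subgradient:
  fixes a b :: "'a::real_inner"
  assumes "p > 1"
  shows "norm b powr p / p + duality_map p b \<bullet> (a - b) \<le> norm a powr p / p"
proof -
  define q where "q = p / (p - 1)"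
  have q: "q > 1" "1 / p + 1 / q = 1" "(p - 1) * q = p"
    using assms by (auto simp: q_def field_simps)
  have "duality_map p b \<bullet> a \<le> norm b powr (p - 1) * norm a"
    using norm_cauchy_schwarz[of "duality_map p b" a] by (simp add: norm_duality_map)
  also have "\<dots> \<le> norm a powr p / p + (norm b powr (p - 1)) powr q / q"
    using Youngs_inequality[OF assms q(1,2), of "norm a" "norm b powr (p - 1)"] by (simp add: mult.commute)
  also have "\<dots> = norm a powr p / p + norm b powr p / q"
    using q by (simp add: powr_powr)
  finally have "duality_map p b \<bullet> (a - b) \<le> norm a powr p / p + norm b powr p / q - norm b powr p"
    by (simp add: inner_diff_right duality_map_inner_self)
  moreover have "norm b powr p = norm b powr p / p + norm b powr p / q"
    using q(2) by (metis add_divide_distrib mult.right_neutral distrib_left times_divide_eq_right)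
  ultimately show ?thesis by linarith
qed

text \<open>At \<open>0\<close> the scalar factor may blow up, so continuity is read off from the
  norm \<open>norm b powr (p - 1)\<close>, whose exponent is positive.\<close>

lemma isCont_duality_map:
  fixes b :: "'a::real_inner"
  assumes "p > 1"
  shows "isCont (duality_map p) b"
proof (cases "b = 0")
  case False
  then show ?thesis
    unfolding duality_map_def by (intro continuous_intros) auto
next
  case True
  have "((\<lambda>x::'a. norm x powr (p - 1)) \<longlongrightarrow> norm (0::'a) powr (p - 1)) (at 0)"
    using assms by (intro tendsto_intros) auto
  then have "((\<lambda>x::'a. norm (duality_map p x)) \<longlongrightarrow> 0) (at 0)"
    by (simp add: norm_duality_map)
  then have "(duality_map p \<longlongrightarrow> 0) (at (0::'a))"
    by (rule tendsto_norm_zero_cancel)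
  then show ?thesis using True by (simp add: isCont_def duality_map_def)
qed

lemma borel_measurable_duality_map [measurable]:
  "duality_map p \<in> borel_measurable (borel :: 'a::euclidean_space measure)"
  unfolding duality_map_def by measurable

section \<open>Lebesgue spaces and their duality\<close>

lemma integrable_norm_powr_add:
  fixes f g :: "'x \<Rightarrow> 'b::euclidean_space"
  assumes "p > 1" and [measurable]: "f \<in> borel_measurable M" "g \<in> borel_measurable M"
    and "integrable M (\<lambda>x. norm (f x) powr p)" "integrable M (\<lambda>x. norm (g x) powr p)"
  shows "integrable M (\<lambda>x. norm (f x + g x) powr p)"
proof (rule Bochner_Integration.integrable_bound)
  show "integrable M (\<lambda>x. 2 powr p * (norm (f x) powr p + norm (g x) powr p))"
    using assms by (intro integrable_mult_right Bochner_Integration.integrable_add)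
  show "AE x in M. norm (norm (f x + g x) powr p)
      \<le> norm (2 powr p * (norm (f x) powr p + norm (g x) powr p))"
    using norm_add_powr_le[OF assms(1)] by (auto intro!: AE_I2)
qed measurable

lemma norm_scaleR_powr: "norm (c *\<^sub>R x) powr p = \<bar>c\<bar> powr p * norm x powr p"
  by (simp add: powr_mult)

lemma integrable_norm_powr_scaleR:
  fixes f :: "'x \<Rightarrow> 'b::euclidean_space"
  assumes "integrable M (\<lambda>x. norm (f x) powr p)"
  shows "integrable M (\<lambda>x. norm (c *\<^sub>R f x) powr p)"
  using assms by (simp only: norm_scaleR_powr) simp

lemma integrable_inner_Lp:
  fixes f g :: "'x \<Rightarrow> 'b::euclidean_space"
  assumes pq: "p > 1" "q > 1" "1 / p + 1 / q = 1"
    and [measurable]: "f \<in> borel_measurable M" "g \<in> borel_measurable M"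
    and "integrable M (\<lambda>x. norm (f x) powr p)" "integrable M (\<lambda>x. norm (g x) powr q)"
  shows "integrable M (\<lambda>x. f x \<bullet> g x)"
proof (rule Bochner_Integration.integrable_bound)
  show "integrable M (\<lambda>x. norm (f x) powr p / p + norm (g x) powr q / q)"
    using assms by auto
  have "\<bar>f x \<bullet> g x\<bar> \<le> norm (f x) powr p / p + norm (g x) powr q / q" for x
    using Youngs_inequality[OF pq, of "norm (f x)" "norm (g x)"] Cauchy_Schwarz_ineq2[of "f x" "g x"]
    by auto
  then show "AE x in M. norm (f x \<bullet> g x) \<le> norm (norm (f x) powr p / p + norm (g x) powr q / q)"
    using pq by (auto intro!: AE_I2)
qed measurable

lemma AE_eq_0_if_integral_powr_eq_0:
  fixes f :: "'x \<Rightarrow> 'b::euclidean_space"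
  assumes [measurable]: "f \<in> borel_measurable M"
    and "integrable M (\<lambda>x. norm (f x) powr p)" "(\<integral>x. norm (f x) powr p \<partial>M) = 0"
  shows "AE x in M. f x = 0"
  using integral_nonneg_eq_0_iff_AE[OF assms(2)] assms(3) by auto

lemma Hoelder_inner:
  fixes f g :: "'x \<Rightarrow> 'b::euclidean_space"
  assumes pq: "p > 1" "q > 1" "1 / p + 1 / q = 1"
    and [measurable]: "f \<in> borel_measurable M" "g \<in> borel_measurable M"
    and f: "integrable M (\<lambda>x. norm (f x) powr p)" and g: "integrable M (\<lambda>x. norm (g x) powr q)"
  shows "\<bar>\<integral>x. f x \<bullet> g x \<partial>M\<bar>
    \<le> (\<integral>x. norm (f x) powr p \<partial>M) powr (1 / p) * (\<integral>x. norm (g x) powr q \<partial>M) powr (1 / q)"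
proof -
  define A where "A = (\<integral>x. norm (f x) powr p \<partial>M)"
  define B where "B = (\<integral>x. norm (g x) powr q \<partial>M)"
  have nonneg: "A \<ge> 0" "B \<ge> 0" by (auto simp: A_def B_def)
  show ?thesis
  proof (cases "A = 0 \<or> B = 0")
    case True
    then have "AE x in M. f x \<bullet> g x = 0"
    proof
      assume "A = 0"
      then have "AE x in M. f x = 0" using AE_eq_0_if_integral_powr_eq_0[OF _ f] by (simp add: A_def)
      then show ?thesis by eventually_elim simp
    next
      assume "B = 0"
      then have "AE x in M. g x = 0" using AE_eq_0_if_integral_powr_eq_0[OF _ g] by (simp add: B_def)
      then show ?thesis by eventually_elim simp
    qed
    then have "(\<integral>x. f x \<bullet> g x \<partial>M) = 0" by (simp add: integral_eq_zero_AE)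
    then show ?thesis by simp
  next
    case False
    with nonneg have pos: "A > 0" "B > 0" by auto
    \<comment> \<open>Dividing \<open>f\<close> and \<open>g\<close> by their norms \<open>a\<close>
      and \<open>b\<close> makes the integrated Young bound equal to
      \<open>1 / p + 1 / q = 1\<close>.\<close>
    define a where "a = A powr (1 / p)"
    define b where "b = B powr (1 / q)"
    have ab: "a > 0" "b > 0" "a powr p = A" "b powr q = B"
      using pos pq by (auto simp: a_def b_def powr_powr)
    have le: "\<bar>f x \<bullet> g x\<bar> \<le> a * b * (norm (f x) powr p / (A * p) + norm (g x) powr q / (B * q))" for x
    proof -
      have "\<bar>f x \<bullet> g x\<bar> \<le> norm (f x) * norm (g x)" by (rule Cauchy_Schwarz_ineq2)
      also have "\<dots> = a * b * (norm (f x) / a * (norm (g x) / b))" using ab by simp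
      also have "\<dots> \<le> a * b * ((norm (f x) / a) powr p / p + (norm (g x) / b) powr q / q)"
        using ab by (intro mult_left_mono Youngs_inequality pq) auto
      also have "\<dots> = a * b * (norm (f x) powr p / (A * p) + norm (g x) powr q / (B * q))"
        using ab by (simp add: powr_divide)
      finally show ?thesis .
    qed
    have "\<bar>\<integral>x. f x \<bullet> g x \<partial>M\<bar> \<le> (\<integral>x. \<bar>f x \<bullet> g x\<bar> \<partial>M)"
      by (rule integral_abs_bound)
    also have "\<dots> \<le> (\<integral>x. a * b * (norm (f x) powr p / (A * p) + norm (g x) powr q / (B * q)) \<partial>M)"
      using assms by (intro integral_mono le integrable_abs integrable_inner_Lp[where p = p and q = q]) auto
    also have "\<dots> = a * b * (A / (A * p) + B / (B * q))"
      using f g by (simp add: A_def B_def)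
    also have "\<dots> = a * b" using pos pq by simp
    finally show ?thesis by (simp add: a_def b_def A_def B_def)
  qed
qed

text \<open>If \<open>D\<close> is the \<open>p\<close>-th root of the integrable function \<open>\<Sum>n. 2\<^sup>n\<^sup>p |G (n+1) - G n|\<^sup>p\<close>, then
  \<open>|G (n+1) - G n| \<le> D / 2\<^sup>n\<close> pointwise, hence \<open>|G n| \<le> |G 0| + 2 D\<close>.\<close>

lemma Lp_fast_Cauchy_dominated:
  fixes G :: "nat \<Rightarrow> 'x \<Rightarrow> 'b::euclidean_space"
  assumes p: "p > 1" and [measurable]: "\<And>n. G n \<in> borel_measurable M"
    and int: "\<And>n. integrable M (\<lambda>x. norm (G n x) powr p)"
    and fast: "\<And>n. (\<integral>x. norm (G (Suc n) x - G n x) powr p \<partial>M) \<le> 1 / (2 * 2 powr p) ^ n"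
  obtains g w where "g \<in> borel_measurable M" "integrable M w"
    "AE x in M. (\<lambda>n. G n x) \<longlonglongrightarrow> g x" "AE x in M. \<forall>n. norm (G n x) powr p \<le> w x"
proof -
  \<comment> \<open>Of the rate \<open>1 / (2 * 2 powr p) ^ n\<close>, the part
    \<open>(2 powr p) ^ n\<close> pays for the weight in \<open>f\<close>; the remaining
    \<open>1 / 2 ^ n\<close> makes the integrals summable.\<close>
  define f where "f = (\<lambda>n x. (2 powr p) ^ n * norm (G (Suc n) x - G n x) powr p)"
  have f_nonneg: "f n x \<ge> 0" for n x by (simp add: f_def)
  have f_int: "integrable M (f n)" for n
  proof -
    have "integrable M (\<lambda>x. norm (G (Suc n) x + (-1) *\<^sub>R G n x) powr p)"
      using p int integrable_norm_powr_scaleR[OF int, of "-1"] by (intro integrable_norm_powr_add) auto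
    then show ?thesis unfolding f_def by (intro integrable_mult_right) simp
  qed
  have f_le: "(\<integral>x. f n x \<partial>M) \<le> (1 / 2) ^ n" for n
  proof -
    have "(\<integral>x. f n x \<partial>M) = (2 powr p) ^ n * (\<integral>x. norm (G (Suc n) x - G n x) powr p \<partial>M)"
      by (simp add: f_def)
    also have "\<dots> \<le> (2 powr p) ^ n * (1 / (2 * 2 powr p) ^ n)"
      by (intro mult_left_mono fast) simp
    finally show ?thesis by (simp add: power_mult_distrib power_one_over)
  qed
  have f_sum: "summable (\<lambda>n. \<integral>x. f n x \<partial>M)"
    by (rule summable_comparison_test'[of "\<lambda>n. (1 / 2) ^ n"])
      (use f_le in \<open>auto simp: f_nonneg summable_geometric\<close>)
  have AE_sum: "AE x in M. summable (\<lambda>n. f n x)"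
  proof -
    have "(\<integral>\<^sup>+x. (\<Sum>n. ennreal (f n x)) \<partial>M) = (\<Sum>n. \<integral>\<^sup>+x. ennreal (f n x) \<partial>M)"
      using f_int by (intro nn_integral_suminf) auto
    also have "\<dots> = (\<Sum>n. ennreal (\<integral>x. f n x \<partial>M))"
      by (intro suminf_cong nn_integral_eq_integral f_int) (simp add: f_nonneg)
    also have "\<dots> \<noteq> \<infinity>"
      using f_sum f_nonneg by (subst suminf_ennreal2) auto
    finally have "AE x in M. (\<Sum>n. ennreal (f n x)) \<noteq> \<infinity>"
      using f_int by (intro nn_integral_noteq_infinite) auto
    then show ?thesis
      by eventually_elim (auto intro!: summable_suminf_not_top simp: f_nonneg)
  qed
  define S where "S = (\<lambda>x. \<Sum>n. f n x)"
  have S_int: "integrable M S"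
    unfolding S_def using AE_sum f_sum f_int by (intro integrable_suminf) (auto simp: f_nonneg)
  define w where "w = (\<lambda>x. 2 powr p * (norm (G 0 x) powr p + 2 powr p * S x))"
  have w_int: "integrable M w" unfolding w_def using S_int int by auto
  have main: "convergent (\<lambda>n. G n x) \<and> (\<forall>n. norm (G n x) powr p \<le> w x)"
    if sum: "summable (\<lambda>n. f n x)" for x
  proof -
    define D where "D = S x powr (1 / p)"
    have S0: "S x \<ge> 0" using sum f_nonneg by (auto simp: S_def intro!: suminf_nonneg)
    have D: "D \<ge> 0" "D powr p = S x" using p S0 by (auto simp: D_def powr_powr)
    have d_le: "norm (G (Suc n) x - G n x) \<le> D * (1 / 2) ^ n" for n
    proof -
      have "f n x \<le> S x" unfolding S_def
        using sum_le_suminf[OF sum, of "{n}"] f_nonneg by auto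
      moreover have "f n x = (2 ^ n * norm (G (Suc n) x - G n x)) powr p"
        by (simp add: f_def powr_mult powr_power powr_powr flip: powr_realpow) (simp add: mult.commute)
      ultimately have "(2 ^ n * norm (G (Suc n) x - G n x)) powr p \<le> D powr p" using D by simp
      then have "2 ^ n * norm (G (Suc n) x - G n x) \<le> D"
        using D p by (meson mult_nonneg_nonneg norm_ge_zero not_less powr_less_mono2 zero_le_numeral zero_le_power order_less_trans zero_less_one)
      then show ?thesis by (simp add: power_one_over field_simps)
    qed
    have geo: "summable (\<lambda>n. D * (1 / 2) ^ n)" by (intro summable_mult) simp
    have "summable (\<lambda>n. G (Suc n) x - G n x)"
      by (rule summable_comparison_test'[OF geo]) (use d_le in auto)
    then have "convergent (\<lambda>n. G 0 x + (\<Sum>k<n. G (Suc k) x - G k x))"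
      by (intro convergent_add convergent_const) (simp add: summable_iff_convergent)
    then have conv: "convergent (\<lambda>n. G n x)"
      by (simp add: sum_lessThan_telescope[of "\<lambda>n. G n x"])
    have "norm (G n x) \<le> norm (G 0 x) + 2 * D" for n
    proof -
      \<comment> \<open>The subtracted tail makes the induction close: it shrinks by exactly
        \<open>D * (1 / 2) ^ n\<close>, the bound on the next increment.\<close>
      have "norm (G n x) \<le> norm (G 0 x) + 2 * D - 2 * D * (1 / 2) ^ n"
      proof (induction n)
        case (Suc n)
        have "norm (G (Suc n) x) \<le> norm (G n x) + norm (G (Suc n) x - G n x)"
          using norm_triangle_ineq[of "G n x" "G (Suc n) x - G n x"] by simp
        then show ?case using Suc d_le[of n] by simp
      qed simp
      then show ?thesis using D by (smt (verit) mult_nonneg_nonneg zero_le_power divide_nonneg_nonneg)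
    qed
    then have "norm (G n x) powr p \<le> (norm (G 0 x) + 2 * D) powr p" for n
      using p by (intro powr_mono2) auto
    moreover have "(norm (G 0 x) + 2 * D) powr p \<le> w x"
      using norm_add_powr_le[OF p, of "norm (G 0 x)" "2 * D"] D by (simp add: w_def powr_mult)
    ultimately show ?thesis using conv order_trans by blast
  qed
  have "AE x in M. (\<lambda>n. G n x) \<longlonglongrightarrow> lim (\<lambda>n. G n x)"
    using AE_sum by eventually_elim (use main convergent_LIMSEQ_iff in blast)
  moreover have "AE x in M. \<forall>n. norm (G n x) powr p \<le> w x"
    using AE_sum by eventually_elim (use main in blast)
  moreover have "(\<lambda>x. lim (\<lambda>n. G n x)) \<in> borel_measurable M"
    by measurable
  ultimately show ?thesis using that w_int by blast
qed

text \<open>A functional bounded by \<open>K\<close> on a subspace \<open>W\<close> of \<open>L\<^sup>p\<close> is represented by minimising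
  \<open>J G = (\<integral>|G|\<^sup>p) / p - l G\<close> over \<open>W\<close>: uniform convexity makes minimising sequences Cauchy, and
  the Euler-Lagrange equation of the limit \<open>g\<close> says that \<open>|g|\<^sup>p\<^sup>-\<^sup>2 g\<close> represents \<open>l\<close>.\<close>

lemma Lp_functional_representation:
  fixes W :: "('x \<Rightarrow> 'b::euclidean_space) set" and l :: "('x \<Rightarrow> 'b) \<Rightarrow> real" and p q K :: real
  assumes pq: "p > 1" "q > 1" "1 / p + 1 / q = 1" and K: "K \<ge> 0"
    and meas: "\<And>G. G \<in> W \<Longrightarrow> G \<in> borel_measurable M"
    and int: "\<And>G. G \<in> W \<Longrightarrow> integrable M (\<lambda>x. norm (G x) powr p)"
    and zero: "(\<lambda>_. 0) \<in> W"
    and add: "\<And>G H. G \<in> W \<Longrightarrow> H \<in> W \<Longrightarrow> (\<lambda>x. G x + H x) \<in> W"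
    and scale: "\<And>c G. G \<in> W \<Longrightarrow> (\<lambda>x. c *\<^sub>R G x) \<in> W"
    and l_add: "\<And>G H. G \<in> W \<Longrightarrow> H \<in> W \<Longrightarrow> l (\<lambda>x. G x + H x) = l G + l H"
    and l_scale: "\<And>c G. G \<in> W \<Longrightarrow> l (\<lambda>x. c *\<^sub>R G x) = c * l G"
    and bound: "\<And>G. G \<in> W \<Longrightarrow> \<bar>l G\<bar> \<le> K * (\<integral>x. norm (G x) powr p \<partial>M) powr (1 / p)"
  obtains F where "F \<in> borel_measurable M" "integrable M (\<lambda>x. norm (F x) powr q)"
    "(\<integral>x. norm (F x) powr q \<partial>M) powr (1 / q) \<le> K"
    "\<And>G. G \<in> W \<Longrightarrow> (\<integral>x. F x \<bullet> G x \<partial>M) = l G"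
proof -
  note p = pq(1)
  have p1q: "(p - 1) * q = p" using pq by (simp add: field_simps)
  define I where "I = (\<lambda>G :: 'x \<Rightarrow> 'b. \<integral>x. norm (G x) powr p \<partial>M)"
  define J where "J = (\<lambda>G. I G / p - l G)"
  \<comment> \<open>Young's inequality is applied to \<open>K * s\<close> with weight
    \<open>2 powr (1 / p)\<close> so that \<open>l\<close> absorbs only half of
    \<open>I G / p\<close>; the other half keeps \<open>J\<close> coercive.\<close>
  define B where "B = (2 powr (1 / p) * K) powr q / q"
  have I_nonneg: "I G \<ge> 0" for G by (simp add: I_def)
  have B0: "B \<ge> 0" using pq by (simp add: B_def)

  have l_le: "\<bar>l G\<bar> \<le> I G / (2 * p) + B" if "G \<in> W" for G
  proof -
    define s where "s = I G powr (1 / p)"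
    have s: "s \<ge> 0" "s powr p = I G" using p I_nonneg[of G] by (auto simp: s_def powr_powr)
    have "K * s = (s / 2 powr (1 / p)) * (2 powr (1 / p) * K)" by simp
    also have "\<dots> \<le> (s / 2 powr (1 / p)) powr p / p + B"
      unfolding B_def using s K by (intro Youngs_inequality pq) auto
    also have "(s / 2 powr (1 / p)) powr p / p = I G / (2 * p)"
      using s p by (simp add: powr_divide powr_powr)
    finally show ?thesis using bound[OF that] by (simp add: s_def I_def)
  qed
  have J_ge: "I G / (2 * p) - B \<le> J G" if "G \<in> W" for G
  proof -
    have "I G / p = I G / (2 * p) + I G / (2 * p)" by simp
    then show ?thesis using l_le[OF that] by (simp add: J_def)
  qed
  have bdd: "bdd_below (J ` W)"
  proof (rule bdd_belowI2)
    fix G assume "G \<in> W"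
    have "0 \<le> I G / (2 * p)" using I_nonneg[of G] p by simp
    then show "- B \<le> J G" using J_ge[OF \<open>G \<in> W\<close>] by linarith
  qed
  define m where "m = (INF G \<in> W. J G)"
  have m_le: "m \<le> J G" if "G \<in> W" for G
    unfolding m_def by (rule cINF_lower[OF bdd that])
  have near_min: "\<exists>G \<in> W. J G < m + \<eta>" if "\<eta> > 0" for \<eta>
    using cInf_lessD[of "J ` W" "m + \<eta>"] zero that by (auto simp: m_def)

  have close: "\<exists>\<eta>. 0 < \<eta> \<and> (\<forall>G \<in> W. \<forall>H \<in> W. J G \<le> m + \<eta> \<longrightarrow> J H \<le> m + \<eta> \<longrightarrow> I (\<lambda>x. G x - H x) \<le> e)"
    if e: "e > 0" for e
  proof -
    define R where "R = 2 * p * (m + 1 + B)"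
    have I_le: "I G \<le> R" if "G \<in> W" "J G \<le> m + 1" for G
    proof -
      have "I G / (2 * p) \<le> m + 1 + B" using J_ge[OF that(1)] that(2) by linarith
      then show ?thesis using p by (simp add: R_def field_simps)
    qed
    obtain G0 where "G0 \<in> W" "J G0 < m + 1" using near_min[of 1] by auto
    then have R0: "R \<ge> 0" using I_le[of G0] I_nonneg[of G0] by auto
    \<comment> \<open>\<open>R\<close> bounds the energies of near-minimisers. With
      \<open>\<epsilon>\<close> and the later \<open>\<eta>\<close>, the energy term and the defect
      term each contribute at most \<open>e / 2\<close>; the \<open>min 1\<close> in
      \<open>\<eta>\<close> keeps the bound \<open>R\<close> applicable.\<close>
    define \<epsilon> where "\<epsilon> = e / (4 * (R + 1))"
    have \<epsilon>: "\<epsilon> > 0" "\<epsilon> * (2 * R) \<le> e / 2" using e R0 by (auto simp: \<epsilon>_def field_simps)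
    obtain C where C: "C > 0"
      "\<And>a b :: 'b. norm (a - b) powr p \<le> \<epsilon> * (norm a powr p + norm b powr p)
        + C * ((norm a powr p + norm b powr p) / 2 - norm ((a + b) /\<^sub>R 2) powr p)"
      using uniform_convexity_powr[OF p \<epsilon>(1)] by blast
    define \<eta> where "\<eta> = min 1 (e / (2 * C * p))"
    have \<eta>: "\<eta> > 0" "\<eta> \<le> 1" "C * (p * \<eta>) \<le> e / 2"
    proof -
      have "C * (p * \<eta>) \<le> C * (p * (e / (2 * C * p)))"
        using C p by (intro mult_left_mono) (auto simp: \<eta>_def)
      then show "C * (p * \<eta>) \<le> e / 2" using C p by simp
    qed (use e C p in \<open>auto simp: \<eta>_def\<close>)
    have "I (\<lambda>x. G x - H x) \<le> e"
      if GH: "G \<in> W" "H \<in> W" "J G \<le> m + \<eta>" "J H \<le> m + \<eta>" for G H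
    proof -
      define mid where "mid = (\<lambda>x. (G x + H x) /\<^sub>R 2)"
      have mid: "mid \<in> W" unfolding mid_def by (intro scale add GH)
      have "l mid = (l G + l H) / 2"
        unfolding mid_def using GH by (subst l_scale) (auto intro: add simp: l_add)
      moreover have "m \<le> J mid" by (rule m_le[OF mid])
      moreover have "(I G + I H) / 2 / p = (I G / p + I H / p) / 2"
        by (simp add: add_divide_distrib)
      \<comment> \<open>The linear part \<open>l\<close> cancels at the midpoint, so near-minimality
        of \<open>G\<close> and \<open>H\<close> against \<open>m \<le> J mid\<close> bounds the
        convexity defect of the energy alone.\<close>
      ultimately have "(I G + I H) / 2 / p - I mid / p \<le> \<eta>"
        using GH(3,4) unfolding J_def by argo
      then have "((I G + I H) / 2 - I mid) / p \<le> \<eta>" by (simp add: diff_divide_distrib)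
      then have defect: "(I G + I H) / 2 - I mid \<le> p * \<eta>"
        using p by (simp add: pos_divide_le_eq mult.commute)
      have [measurable]: "G \<in> borel_measurable M" "H \<in> borel_measurable M" using meas GH by auto
      note ints = int[OF GH(1)] int[OF GH(2)] int[OF mid]
      have "I (\<lambda>x. G x - H x) \<le> (\<integral>x. \<epsilon> * (norm (G x) powr p + norm (H x) powr p)
          + C * ((norm (G x) powr p + norm (H x) powr p) / 2 - norm (mid x) powr p) \<partial>M)"
        unfolding I_def
      proof (intro integral_mono)
        have "(\<lambda>x. G x + (-1) *\<^sub>R H x) \<in> W" by (intro add scale GH)
        from int[OF this] show "integrable M (\<lambda>x. norm (G x - H x) powr p)" by simp
      qed (use ints C(2) in \<open>auto simp: mid_def\<close>)
      also have "\<dots> = \<epsilon> * (I G + I H) + C * ((I G + I H) / 2 - I mid)"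
        using ints by (simp add: I_def)
      also have "\<dots> \<le> \<epsilon> * (2 * R) + C * (p * \<eta>)"
        using \<epsilon> C(1) defect I_le[OF GH(1)] I_le[OF GH(2)] GH(3,4) \<eta>(2)
        by (intro add_mono mult_left_mono) auto
      also have "\<dots> \<le> e" using \<epsilon> \<eta> by simp
      finally show ?thesis .
    qed
    with \<eta>(1) show ?thesis by blast
  qed
  define c where "c = 2 * 2 powr p"
  have c: "1 / c ^ n > 0" for n by (simp add: c_def)
  obtain \<eta> where \<eta>: "\<And>n. \<eta> n > 0"
    "\<And>n G H. G \<in> W \<Longrightarrow> H \<in> W \<Longrightarrow> J G \<le> m + \<eta> n \<Longrightarrow> J H \<le> m + \<eta> n \<Longrightarrow> I (\<lambda>x. G x - H x) \<le> 1 / c ^ n"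
    using close[OF c] by metis
  \<comment> \<open>The minimum over all indices up to \<open>n\<close> makes both
    \<open>G n\<close> and \<open>G (Suc n)\<close> admissible for \<open>\<eta> n\<close>. The cap
    \<open>(1 / 4) ^ n\<close> is the square of the step used for the Euler-Lagrange
    equation.\<close>
  define \<zeta> where "\<zeta> = (\<lambda>n. min ((1 / 4) ^ n) (Min (\<eta> ` {..n})))"
  have \<zeta>: "\<zeta> n > 0" for n using \<eta>(1) by (simp add: \<zeta>_def)
  obtain G where G: "\<And>n. G n \<in> W" "\<And>n. J (G n) < m + \<zeta> n"
    using near_min[OF \<zeta>] by metis
  have JG: "J (G n) \<le> m + (1 / 4) ^ n" for n using G(2)[of n] by (simp add: \<zeta>_def)
  have GM [measurable]: "G n \<in> borel_measurable M" for n using G meas by blast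
  have fast: "(\<integral>x. norm (G (Suc n) x - G n x) powr p \<partial>M) \<le> 1 / (2 * 2 powr p) ^ n" for n
  proof -
    have "\<zeta> (Suc n) \<le> \<eta> n" "\<zeta> n \<le> \<eta> n"
      by (auto simp: \<zeta>_def intro!: min.coboundedI2 Min_le)
    then show ?thesis
      using \<eta>(2)[OF G(1) G(1), of "Suc n" n n] G(2)[of n] G(2)[of "Suc n"]
      by (simp add: I_def c_def)
  qed
  obtain g w where gw: "g \<in> borel_measurable M" "integrable M w"
    "AE x in M. (\<lambda>n. G n x) \<longlonglongrightarrow> g x" "AE x in M. \<forall>n. norm (G n x) powr p \<le> w x"
    using Lp_fast_Cauchy_dominated[where G = G, OF p GM int[OF G(1)] fast] by blast
  note [measurable] = gw(1)
  have lim: "AE x in M. (\<lambda>n. norm (G n x) powr p) \<longlonglongrightarrow> norm (g x) powr p"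
    using gw(3) by eventually_elim (use p in \<open>auto intro!: tendsto_intros\<close>)
  have dom: "AE x in M. norm (norm (G n x) powr p) \<le> w x" for n
    using gw(4) by eventually_elim auto
  have g_int: "integrable M (\<lambda>x. norm (g x) powr p)"
    by (rule integrable_dominated_convergence[OF _ _ gw(2) lim dom]) measurable
  have I_lim: "(\<lambda>n. I (G n)) \<longlonglongrightarrow> I g"
    unfolding I_def by (rule integral_dominated_convergence[OF _ _ gw(2) lim dom]) measurable

  define F where "F = (\<lambda>x. duality_map p (g x))"
  have F_meas [measurable]: "F \<in> borel_measurable M" unfolding F_def by measurable
  have F_powr: "norm (F x) powr q = norm (g x) powr p" for x
    by (simp add: F_def norm_duality_map powr_powr p1q)
  have F_int: "integrable M (\<lambda>x. norm (F x) powr q)" using g_int by (simp add: F_powr)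
  have dm_le: "\<bar>duality_map p b \<bullet> a\<bar> \<le> norm b powr p + norm a powr p" for a b :: 'b
  proof -
    have "\<bar>duality_map p b \<bullet> a\<bar> \<le> norm a * norm b powr (p - 1)"
      using Cauchy_Schwarz_ineq2[of "duality_map p b" a] by (simp add: norm_duality_map mult.commute)
    also have "\<dots> \<le> norm a powr p / p + (norm b powr (p - 1)) powr q / q"
      by (intro Youngs_inequality pq) auto
    also have "\<dots> = norm a powr p / p + norm b powr p / q" by (simp add: powr_powr p1q)
    also have "\<dots> \<le> norm a powr p + norm b powr p"
      using pq by (intro add_mono divide_left_mono[where b = 1, simplified]) auto
    finally show ?thesis by simp
  qed

  have EL_le: "l H \<le> (\<integral>x. F x \<bullet> H x \<partial>M)" if H: "H \<in> W" for H
  proof -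
    have HM [measurable]: "H \<in> borel_measurable M" by (rule meas[OF H])
    \<comment> \<open>The subgradient is taken at the perturbed point \<open>b n\<close>, not at
      \<open>G n\<close>; this gives the upper bound for \<open>I (b n) - I (G n)\<close> that
      near-minimality of \<open>G n\<close> can be played against.\<close>
    define b where "b = (\<lambda>n x. G n x + (1 / 2) ^ n *\<^sub>R H x)"
    have b_W: "b n \<in> W" for n unfolding b_def by (intro add scale G H)
    have b_meas [measurable]: "b n \<in> borel_measurable M" for n unfolding b_def by measurable
    have bH_int: "integrable M (\<lambda>x. duality_map p (b n x) \<bullet> H x)" for n
    proof (rule Bochner_Integration.integrable_bound)
      show "integrable M (\<lambda>x. norm (b n x) powr p + norm (H x) powr p)"
        using int[OF b_W] int[OF H] by auto
    qed (use dm_le in \<open>auto intro!: AE_I2\<close>)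
    have step: "l H \<le> (\<integral>x. duality_map p (b n x) \<bullet> H x \<partial>M) + (1 / 2) ^ n" for n
    proof -
      define t where "t = (1 / 2 :: real) ^ n"
      have t: "t > 0" "t * t = (1 / 4) ^ n" by (simp_all add: t_def flip: power_mult_distrib)
      have "norm (b n x) powr p / p - t * (duality_map p (b n x) \<bullet> H x) \<le> norm (G n x) powr p / p" for x
        using norm_powr_subgradient[OF p, of "b n x" "G n x"] by (simp add: b_def t_def)
      then have "(\<integral>x. norm (b n x) powr p / p - t * (duality_map p (b n x) \<bullet> H x) \<partial>M)
          \<le> (\<integral>x. norm (G n x) powr p / p \<partial>M)"
        using int[OF b_W] int[OF G(1)] bH_int by (intro integral_mono) auto
      then have "I (b n) / p - t * (\<integral>x. duality_map p (b n x) \<bullet> H x \<partial>M) \<le> I (G n) / p"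
        using int[OF b_W] bH_int by (simp add: I_def)
      moreover have "l (b n) = l (G n) + t * l H"
        unfolding b_def t_def using G H by (simp add: l_add scale l_scale)
      moreover have "J (G n) - t * t \<le> J (b n)"
        using JG[of n] m_le[OF b_W, of n] t by simp
      \<comment> \<open>Near-minimality costs \<open>t * t\<close>, so dividing by the step
        \<open>t\<close> leaves an error \<open>t\<close>, which tends to \<open>0\<close>.\<close>
      ultimately have "t * l H \<le> t * ((\<integral>x. duality_map p (b n x) \<bullet> H x \<partial>M) + t)"
        by (simp add: J_def algebra_simps)
      then show ?thesis using t(1) by (simp add: t_def)
    qed
    have "(\<lambda>n. \<integral>x. duality_map p (b n x) \<bullet> H x \<partial>M) \<longlonglongrightarrow> (\<integral>x. F x \<bullet> H x \<partial>M)"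
    proof (rule integral_dominated_convergence)
      show "integrable M (\<lambda>x. 2 powr p * (w x + norm (H x) powr p) + norm (H x) powr p)"
        using gw(2) int[OF H] by auto
      show "AE x in M. (\<lambda>n. duality_map p (b n x) \<bullet> H x) \<longlonglongrightarrow> F x \<bullet> H x"
        using gw(3)
      proof eventually_elim
        case (elim x)
        have "(\<lambda>n. b n x) \<longlonglongrightarrow> g x + 0 *\<^sub>R H x"
          unfolding b_def by (intro tendsto_intros elim LIMSEQ_power_zero) auto
        then have "(\<lambda>n. duality_map p (b n x)) \<longlonglongrightarrow> F x"
          unfolding F_def by (intro isCont_tendsto_compose[OF isCont_duality_map[OF p]]) simp
        then show ?case by (intro tendsto_intros)
      qed
      show "AE x in M. norm (duality_map p (b n x) \<bullet> H x)
          \<le> 2 powr p * (w x + norm (H x) powr p) + norm (H x) powr p" for n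
        using gw(4)
      proof eventually_elim
        case (elim x)
        have "norm ((1 / 2) ^ n *\<^sub>R H x) \<le> norm (H x)"
          by (simp add: mult_left_le_one_le power_le_one)
        then have "norm ((1 / 2) ^ n *\<^sub>R H x) powr p \<le> norm (H x) powr p"
          using p by (intro powr_mono2) auto
        then have "2 powr p * (norm (G n x) powr p + norm ((1 / 2) ^ n *\<^sub>R H x) powr p)
            \<le> 2 powr p * (w x + norm (H x) powr p)"
          using elim by (intro mult_left_mono add_mono) auto
        then have "norm (b n x) powr p \<le> 2 powr p * (w x + norm (H x) powr p)"
          using norm_add_powr_le[OF p, of "G n x" "(1 / 2) ^ n *\<^sub>R H x"] unfolding b_def by linarith
        then show ?case using dm_le[of "b n x" "H x"] by simp
      qed
    qed measurable
    moreover have "(\<lambda>n. (1 / 2 :: real) ^ n) \<longlonglongrightarrow> 0" by (intro LIMSEQ_power_zero) auto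
    ultimately have "(\<lambda>n. (\<integral>x. duality_map p (b n x) \<bullet> H x \<partial>M) + (1 / 2) ^ n) \<longlonglongrightarrow> (\<integral>x. F x \<bullet> H x \<partial>M) + 0"
      by (intro tendsto_add)
    then show ?thesis using step by (intro LIMSEQ_le_const[of _ _ "l H"]) auto
  qed
  have EL: "(\<integral>x. F x \<bullet> H x \<partial>M) = l H" if H: "H \<in> W" for H
    using EL_le[OF H] EL_le[OF scale[OF H, of "-1"]] l_scale[OF H, of "-1"] by simp

  have "(\<integral>x. norm (F x) powr q \<partial>M) powr (1 / q) \<le> K"
  proof -
    \<comment> \<open>As \<open>g\<close> may lie outside \<open>W\<close>, the bound on
      \<open>l\<close> is transferred to it along \<open>G n\<close>. It yields
      \<open>I g \<le> K * I g powr (1 / p)\<close>, and cancelling leaves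
      \<open>I g powr (1 / q) \<le> K\<close>, where \<open>I g\<close> is also the integral of
      \<open>norm (F x) powr q\<close>.\<close>
    have "(\<lambda>n. l (G n)) \<longlonglongrightarrow> (\<integral>x. F x \<bullet> g x \<partial>M)"
      unfolding EL[OF G(1), symmetric]
    proof (rule integral_dominated_convergence)
      show "integrable M (\<lambda>x. norm (g x) powr p + w x)" using g_int gw(2) by auto
      show "AE x in M. (\<lambda>n. F x \<bullet> G n x) \<longlonglongrightarrow> F x \<bullet> g x"
        using gw(3) by eventually_elim (intro tendsto_intros)
      show "AE x in M. norm (F x \<bullet> G n x) \<le> norm (g x) powr p + w x" for n
        using gw(4) by eventually_elim (use dm_le F_def in \<open>fastforce intro: order_trans\<close>)
    qed measurable
    then have "(\<lambda>n. l (G n)) \<longlonglongrightarrow> I g" by (simp add: F_def duality_map_inner_self I_def)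
    moreover have "(\<lambda>n. K * I (G n) powr (1 / p)) \<longlonglongrightarrow> K * I g powr (1 / p)"
      using p I_nonneg by (intro tendsto_intros I_lim) auto
    moreover have "l (G n) \<le> K * I (G n) powr (1 / p)" for n
      using bound[OF G(1), of n] by (simp add: I_def)
    ultimately have le: "I g \<le> K * I g powr (1 / p)"
      by (intro LIMSEQ_le[of "\<lambda>n. l (G n)"]) auto
    show ?thesis
    proof (cases "I g = 0")
      case True
      then show ?thesis using K by (simp add: F_powr I_def)
    next
      case False
      then have pos: "I g > 0" using I_nonneg[of g] by simp
      have "I g powr (1 / q) * I g powr (1 / p) = I g"
        using pos pq by (simp flip: powr_add add: add.commute)
      then have "I g powr (1 / q) * I g powr (1 / p) \<le> K * I g powr (1 / p)" using le by simp
      then show ?thesis using pos by (simp add: F_powr I_def)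
    qed
  qed
  then show ?thesis using that F_meas F_int EL by blast
qed

section \<open>Signed measures\<close>

lemma signed_borel_measure_Un:
  assumes \<rho>: "signed_borel_measure \<rho>" and "A \<in> sets borel" "B \<in> sets borel" "A \<inter> B = {}"
  shows "\<rho> (A \<union> B) = \<rho> A + \<rho> B"
proof -
  have "disjoint_family (binaryset A B)"
    using assms(4) by (auto simp: disjoint_family_on_def binaryset_def)
  moreover have "range (binaryset A B) \<subseteq> sets borel"
    using assms by (auto simp: range_binaryset_eq)
  ultimately have "(\<lambda>i. \<rho> (binaryset A B i)) sums \<rho> (A \<union> B)"
    using \<rho> unfolding signed_borel_measure_def by (metis UN_binaryset_eq)
  moreover have "(\<lambda>i. \<rho> (binaryset A B i)) sums (\<rho> A + \<rho> B)"
    using \<rho> by (intro binaryset_sums) (auto simp: signed_borel_measure_def)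
  ultimately show ?thesis by (rule sums_unique2)
qed

lemma signed_borel_measure_uminus:
  "signed_borel_measure \<rho> \<Longrightarrow> signed_borel_measure (\<lambda>A. - \<rho> A)"
  by (auto simp: signed_borel_measure_def intro: sums_minus)

text \<open>If \<open>\<rho>\<close> were unbounded, one could split off disjoint sets with \<open>|\<rho>| > 1\<close> forever, always
  keeping a part on which \<open>\<rho>\<close> is unbounded; this contradicts countable additivity.\<close>

lemma signed_borel_measure_bounded:
  assumes \<rho>: "signed_borel_measure \<rho>"
  obtains C where "\<And>B. B \<in> sets borel \<Longrightarrow> \<rho> B \<le> C"
proof (rule ccontr)
  assume no: "\<not> thesis"
  define bad where "bad = (\<lambda>A. A \<in> sets borel \<and> (\<forall>C. \<exists>B \<in> sets borel. B \<subseteq> A \<and> C < \<rho> B))"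
  have "\<exists>B \<in> sets borel. C < \<rho> B" for C
  proof (rule ccontr)
    assume "\<not> (\<exists>B \<in> sets borel. C < \<rho> B)"
    then have "\<rho> B \<le> C" if "B \<in> sets borel" for B using that by (auto simp: not_less)
    then show False using no that by blast
  qed
  then have bad_UNIV: "bad UNIV" unfolding bad_def by simp
  have split: "\<exists>A'. bad A' \<and> A' \<subseteq> A \<and> \<bar>\<rho> (A - A')\<bar> > 1" if A: "bad A" for A
  proof -
    have A_sets: "A \<in> sets borel" using A by (simp add: bad_def)
    \<comment> \<open>The margin makes both pieces large: \<open>\<rho> B > 1\<close>, while
      \<open>\<rho> (A - B) = \<rho> A - \<rho> B < -1\<close>. Either piece may thus be split off,
      and the one kept is chosen to be \<open>bad\<close>.\<close>
    obtain B where B: "B \<in> sets borel" "B \<subseteq> A" "\<bar>\<rho> A\<bar> + 1 < \<rho> B"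
      using A unfolding bad_def by blast
    have "\<rho> (B \<union> (A - B)) = \<rho> B + \<rho> (A - B)"
      using A_sets B by (intro signed_borel_measure_Un \<rho>) auto
    moreover have "B \<union> (A - B) = A" using B by auto
    ultimately have AB: "\<rho> A = \<rho> B + \<rho> (A - B)" by simp
    have "bad B \<or> bad (A - B)"
    proof (rule ccontr)
      assume "\<not> (bad B \<or> bad (A - B))"
      then obtain C1 C2 where C: "\<And>D. D \<in> sets borel \<Longrightarrow> D \<subseteq> B \<Longrightarrow> \<rho> D \<le> C1"
        "\<And>D. D \<in> sets borel \<Longrightarrow> D \<subseteq> A - B \<Longrightarrow> \<rho> D \<le> C2"
        using A_sets B(1) unfolding bad_def by (metis not_less sets.Diff)
      obtain D where D: "D \<in> sets borel" "D \<subseteq> A" "C1 + C2 < \<rho> D"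
        using A unfolding bad_def by blast
      have "\<rho> ((D \<inter> B) \<union> (D - B)) = \<rho> (D \<inter> B) + \<rho> (D - B)"
        using D B by (intro signed_borel_measure_Un \<rho>) auto
      then have "\<rho> D = \<rho> (D \<inter> B) + \<rho> (D - B)" by (simp add: Int_Diff_Un)
      moreover have "\<rho> (D \<inter> B) \<le> C1" "\<rho> (D - B) \<le> C2"
        using C(1)[of "D \<inter> B"] C(2)[of "D - B"] D(1,2) B(1) by auto
      ultimately show False using D by linarith
    qed
    then show ?thesis
    proof
      assume "bad B"
      moreover have "\<bar>\<rho> (A - B)\<bar> > 1" using AB B by linarith
      ultimately show ?thesis using B by blast
    next
      assume "bad (A - B)"
      moreover have "A - (A - B) = B" using B by auto
      ultimately show ?thesis using B by (intro exI[of _ "A - B"]) auto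
    qed
  qed
  have "\<exists>A. \<forall>n. bad (A n) \<and> A (Suc n) \<subseteq> A n \<and> \<bar>\<rho> (A n - A (Suc n))\<bar> > 1"
    by (rule dependent_nat_choice) (use bad_UNIV split in blast)+
  then obtain A where A: "\<And>n. bad (A n)" "\<And>n. A (Suc n) \<subseteq> A n" "\<And>n. \<bar>\<rho> (A n - A (Suc n))\<bar> > 1"
    by blast
  define D where "D = (\<lambda>n. A n - A (Suc n))"
  have anti: "A j \<subseteq> A i" if "i \<le> j" for i j
    by (rule lift_Suc_antimono_le[where f = A, OF A(2) that])
  have "disjoint_family D"
  proof -
    have disj: "D i \<inter> D j = {}" if "i < j" for i j
      using anti[of "Suc i" j] that by (auto simp: D_def)
    show ?thesis unfolding disjoint_family_on_def
    proof (intro ballI impI)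
      fix i j :: nat
      assume "i \<noteq> j"
      then show "D i \<inter> D j = {}"
        using disj[of i j] disj[of j i] by (cases i j rule: linorder_cases) auto
    qed
  qed
  moreover have "range D \<subseteq> sets borel" using A(1) by (auto simp: D_def bad_def)
  ultimately have "(\<lambda>n. \<rho> (D n)) sums \<rho> (\<Union>n. D n)"
    using \<rho> unfolding signed_borel_measure_def by blast
  then have "(\<lambda>n. \<rho> (D n)) \<longlonglongrightarrow> 0" by (intro summable_LIMSEQ_zero sums_summable)
  then obtain n where "norm (\<rho> (D n)) < 1"
    using LIMSEQ_D[of "\<lambda>n. \<rho> (D n)" 0 1] by auto
  moreover have "\<bar>\<rho> (D n)\<bar> > 1" using A(3)[of n] by (simp add: D_def)
  ultimately show False by simp
qed

text \<open>The complement of the support is a possibly uncountable union of open sets on which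
  \<open>\<rho>\<close> vanishes; by Lindelof countably many suffice, and countable additivity
  applies once they are made disjoint.\<close>

lemma signed_borel_measure_off_support:
  fixes \<rho> :: "'a::second_countable_topology set \<Rightarrow> real"
  assumes \<rho>: "signed_borel_measure \<rho>" and B: "B \<in> sets borel" "B \<inter> signed_support \<rho> = {}"
  shows "\<rho> B = 0"
proof -
  define \<U> where "\<U> = {U. open U \<and> (\<forall>B \<in> sets borel. B \<subseteq> U \<longrightarrow> \<rho> B = 0)}"
  have sub: "B \<subseteq> \<Union>\<U>" using B by (auto simp: signed_support_def \<U>_def)
  obtain \<V> where \<V>: "\<V> \<subseteq> \<U>" "countable \<V>" "\<Union>\<V> = \<Union>\<U>"
    using Lindelof_openin[of \<U> UNIV] by (auto simp: \<U>_def)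
  show ?thesis
  proof (cases "\<V> = {}")
    case True
    then have "B = {}" using sub \<V>(3) by auto
    then show ?thesis using \<rho> by (simp add: signed_borel_measure_def)
  next
    case False
    define V where "V = from_nat_into \<V>"
    have V: "V n \<in> \<U>" for n using from_nat_into[OF False] \<V> by (auto simp: V_def)
    have UV: "(\<Union>n. V n) = \<Union>\<U>"
      using \<V> False by (simp add: V_def range_from_nat_into)
    define D where "D = (\<lambda>n. B \<inter> disjointed V n)"
    have V_sets: "V n \<in> sets borel" for n using V[of n] by (auto simp: \<U>_def)
    have D_sets: "D n \<in> sets borel" for n
      using B V_sets unfolding D_def disjointed_def by auto
    have D0: "\<rho> (D n) = 0" for n
      using V[of n] D_sets[of n] disjointed_subset[of V n] by (auto simp: \<U>_def D_def)
    have "disjoint_family D"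
      using disjoint_family_disjointed[of V] by (auto simp: D_def disjoint_family_on_def)
    moreover have DB: "(\<Union>n. D n) = B"
      using sub UV UN_disjointed_eq[of V] by (auto simp: D_def)
    moreover have "range D \<subseteq> sets borel" using D_sets by auto
    ultimately have "(\<lambda>n. \<rho> (D n)) sums \<rho> (\<Union>n. D n)"
      using \<rho> unfolding signed_borel_measure_def by blast
    then show ?thesis unfolding D0 DB using sums_unique2 sums_zero by blast
  qed
qed

lemma sets_pos_variation [measurable_cong, simp]: "sets (pos_variation \<rho>) = sets borel"
proof -
  have "sigma_sets UNIV (sets borel) = sets (borel :: 'a measure)"
    using sets.sigma_sets_eq[of "borel :: 'a measure"] unfolding space_borel .
  then show ?thesis unfolding pos_variation_def by (simp add: sets_measure_of_conv)
qed

lemma space_pos_variation [simp]: "space (pos_variation \<rho>) = UNIV"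
  unfolding pos_variation_def by (simp add: space_measure_of_conv)

text \<open>This holds for every \<open>\<rho>\<close>, because \<open>measure_of\<close> yields the zero measure when its argument
  is not countably additive.\<close>

lemma emeasure_pos_variation_le:
  "emeasure (pos_variation \<rho>) A \<le> (SUP B \<in> {B \<in> sets borel. B \<subseteq> A}. ennreal (\<rho> B))"
  unfolding pos_variation_def by (simp add: emeasure_measure_of_conv)

lemma finite_measure_pos_variation:
  assumes "signed_borel_measure \<rho>"
  shows "finite_measure (pos_variation \<rho>)"
proof
  obtain C where C: "\<And>B. B \<in> sets borel \<Longrightarrow> \<rho> B \<le> C"
    using signed_borel_measure_bounded[OF assms] by blast
  have "emeasure (pos_variation \<rho>) UNIV \<le> (SUP B \<in> {B \<in> sets borel. B \<subseteq> UNIV}. ennreal (\<rho> B))"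
    by (rule emeasure_pos_variation_le)
  also have "\<dots> \<le> ennreal C" using C by (intro SUP_least ennreal_leI) auto
  finally show "emeasure (pos_variation \<rho>) (space (pos_variation \<rho>)) \<noteq> \<infinity>"
    by (auto simp: top_unique)
qed

lemma closed_signed_support: "closed (signed_support \<rho>)"
  unfolding signed_support_def by (intro closed_Compl open_Union) auto

lemma signed_support_uminus: "signed_support (\<lambda>A. - \<rho> A) = signed_support \<rho>"
  by (simp add: signed_support_def)

lemma AE_pos_variation_support:
  fixes \<rho> :: "'a::second_countable_topology set \<Rightarrow> real"
  assumes "signed_borel_measure \<rho>"
  shows "AE x in pos_variation \<rho>. x \<in> signed_support \<rho>"
proof (rule AE_I')
  have S: "- signed_support \<rho> \<in> sets borel"
    using closed_signed_support[of \<rho>] by (simp add: borel_open open_Compl)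
  have "emeasure (pos_variation \<rho>) (- signed_support \<rho>)
      \<le> (SUP B \<in> {B \<in> sets borel. B \<subseteq> - signed_support \<rho>}. ennreal (\<rho> B))"
    by (rule emeasure_pos_variation_le)
  also have "\<dots> \<le> 0"
  proof (intro SUP_least)
    fix B assume "B \<in> {B \<in> sets borel. B \<subseteq> - signed_support \<rho>}"
    then have "\<rho> B = 0" by (intro signed_borel_measure_off_support assms) auto
    then show "ennreal (\<rho> B) \<le> 0" by simp
  qed
  finally show "- signed_support \<rho> \<in> null_sets (pos_variation \<rho>)"
    using S by (auto simp: null_sets_def)
qed auto

text \<open>The variation is finite and concentrated on the compact support, on which a continuous
  function is bounded.\<close>

lemma integrable_pos_variation:
  fixes \<rho> :: "'a::second_countable_topology set \<Rightarrow> real" and u :: "'a \<Rightarrow> real"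
  assumes \<rho>: "signed_borel_measure \<rho>" and K: "compact (signed_support \<rho>)" and u: "continuous_on UNIV u"
  shows "integrable (pos_variation \<rho>) u"
proof -
  have "bounded (u ` signed_support \<rho>)"
    by (intro compact_imp_bounded compact_continuous_image K continuous_on_subset[OF u]) auto
  then obtain C where C: "\<And>x. x \<in> signed_support \<rho> \<Longrightarrow> norm (u x) \<le> C"
    by (auto simp: bounded_iff)
  have "u \<in> borel_measurable borel" using u by (rule borel_measurable_continuous_onI)
  then have "u \<in> borel_measurable (pos_variation \<rho>)" by simp
  moreover have "AE x in pos_variation \<rho>. norm (u x) \<le> C"
    using AE_pos_variation_support[OF \<rho>] by eventually_elim (rule C)
  ultimately show ?thesis
    by (intro finite_measure.integrable_const_bound[OF finite_measure_pos_variation[OF \<rho>]])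
qed

lemma integrable_neg_variation:
  fixes \<rho> :: "'a::second_countable_topology set \<Rightarrow> real" and u :: "'a \<Rightarrow> real"
  assumes "signed_borel_measure \<rho>" "compact (signed_support \<rho>)" "continuous_on UNIV u"
  shows "integrable (neg_variation \<rho>) u"
  unfolding neg_variation_def using assms
  by (intro integrable_pos_variation signed_borel_measure_uminus) (simp_all add: signed_support_uminus)

lemma signed_integral_add:
  fixes \<rho> :: "'a::second_countable_topology set \<Rightarrow> real" and u v :: "'a \<Rightarrow> real"
  assumes "signed_borel_measure \<rho>" "compact (signed_support \<rho>)"
    and "continuous_on UNIV u" "continuous_on UNIV v"
  shows "signed_integral \<rho> (\<lambda>x. u x + v x) = signed_integral \<rho> u + signed_integral \<rho> v"
  using assms by (simp add: signed_integral_def integrable_pos_variation integrable_neg_variation)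

lemma signed_integral_cmult:
  fixes u :: "'a::topological_space \<Rightarrow> real"
  shows "signed_integral \<rho> (\<lambda>x. c * u x) = c * signed_integral \<rho> u"
  by (simp add: signed_integral_def right_diff_distrib)

section \<open>The homogeneous Sobolev space\<close>

text \<open>The Hoelder exponent is positive because \<open>p\<close> exceeds the dimension.\<close>

lemma D1p_continuous:
  fixes u :: "real ^ 'n::finite \<Rightarrow> real"
  assumes u: "u \<in> D1p p" and p: "real CARD('n) < p"
  shows "continuous_on UNIV u"
proof -
  define \<alpha> where "\<alpha> = 1 - real CARD('n) / p"
  have \<alpha>: "\<alpha> > 0" using p by (simp add: \<alpha>_def field_simps)
  obtain C where C: "\<And>x y. dist (u x) (u y) \<le> C * dist x y powr \<alpha>"
    using u unfolding D1p_def hoelder_continuous_def \<alpha>_def by blast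
  have "(u \<longlongrightarrow> u x) (at x)" for x
  proof -
    have "((\<lambda>y. C * dist y x powr \<alpha>) \<longlongrightarrow> C * dist x x powr \<alpha>) (at x)"
      using \<alpha> by (intro tendsto_intros) auto
    then have "((\<lambda>y. C * dist y x powr \<alpha>) \<longlongrightarrow> 0) (at x)" by simp
    then have "((\<lambda>y. dist (u y) (u x)) \<longlongrightarrow> 0) (at x)"
      by (rule tendsto_sandwich[OF always_eventually always_eventually tendsto_const, rotated 2])
        (simp_all only: C zero_le_dist simp_thms)
    then show ?thesis by (subst tendsto_dist_iff)
  qed
  then show ?thesis by (simp add: continuous_on_eq_continuous_at isCont_def)
qed

lemma integrable_mult_locally_integrable:
  fixes u \<psi> :: "'a::euclidean_space \<Rightarrow> real"
  assumes u: "locally_integrable u" and \<psi>: "continuous_on UNIV \<psi>"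
    and K: "compact K" "\<And>x. x \<notin> K \<Longrightarrow> \<psi> x = 0"
  shows "integrable lborel (\<lambda>x. u x * \<psi> x)"
proof -
  have int: "integrable lborel (\<lambda>x. indicator K x *\<^sub>R u x)"
    using u K(1) unfolding locally_integrable_def set_integrable_def by blast
  have \<psi>_meas: "\<psi> \<in> borel_measurable lborel"
    using borel_measurable_continuous_onI[OF \<psi>] by simp
  have "bounded (\<psi> ` K)"
    by (intro compact_imp_bounded compact_continuous_image K continuous_on_subset[OF \<psi>]) auto
  then obtain C where C: "\<And>x. x \<in> K \<Longrightarrow> \<bar>\<psi> x\<bar> \<le> C" by (auto simp: bounded_iff)
  have "integrable lborel (\<lambda>x. (indicator K x *\<^sub>R u x) * \<psi> x)"
  proof (rule Bochner_Integration.integrable_bound)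
    show "integrable lborel (\<lambda>x. C * (indicator K x *\<^sub>R u x))"
      using int by (rule integrable_mult_right)
    show "(\<lambda>x. (indicator K x *\<^sub>R u x) * \<psi> x) \<in> borel_measurable lborel"
      by (intro borel_measurable_times borel_measurable_integrable[OF int] \<psi>_meas)
    show "AE x in lborel. norm ((indicator K x *\<^sub>R u x) * \<psi> x) \<le> norm (C * (indicator K x *\<^sub>R u x))"
    proof (rule AE_I2)
      fix x
      show "norm ((indicator K x *\<^sub>R u x) * \<psi> x) \<le> norm (C * (indicator K x *\<^sub>R u x))"
      proof (cases "x \<in> K")
        case True
        have "\<bar>u x\<bar> * \<bar>\<psi> x\<bar> \<le> \<bar>u x\<bar> * \<bar>C\<bar>"
          using C[OF True] by (intro mult_left_mono) auto
        then show ?thesis using True by (simp add: abs_mult mult.commute)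
      qed simp
    qed
  qed
  moreover have "(\<lambda>x. (indicator K x *\<^sub>R u x) * \<psi> x) = (\<lambda>x. u x * \<psi> x)"
  proof
    show "(indicator K x *\<^sub>R u x) * \<psi> x = u x * \<psi> x" for x
      using K(2)[of x] by (cases "x \<in> K") simp_all
  qed
  ultimately show ?thesis by simp
qed

lemma partial_deriv_eq_0:
  assumes "x \<notin> closure {x. \<phi> x \<noteq> 0}"
  shows "partial_deriv i \<phi> x = 0"
proof -
  have "((\<lambda>_. 0) has_derivative (\<lambda>_. 0)) (at x)" by simp
  then have "(\<phi> has_derivative (\<lambda>_. 0)) (at x)"
  proof (rule has_derivative_transform_within_open)
    show "open (- closure {x. \<phi> x \<noteq> 0})" by (intro open_Compl closed_closure)
    show "0 = \<phi> y" if "y \<in> - closure {x. \<phi> x \<noteq> 0}" for y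
      using that closure_subset[of "{x. \<phi> x \<noteq> 0}"] by auto
  qed (use assms in auto)
  then have "frechet_derivative \<phi> (at x) = (\<lambda>_. 0)" by (rule frechet_derivative_at[symmetric])
  then show ?thesis by (simp add: partial_deriv_def)
qed

text \<open>Needed to split the integrals that define weak derivatives of sums, since Bochner
  integrals are additive only for integrable summands.\<close>

lemma integrable_mult_test_function:
  assumes "locally_integrable u" "\<phi> \<in> test_functions"
  shows "integrable lborel (\<lambda>x. u x * \<phi> x)" "integrable lborel (\<lambda>x. u x * partial_deriv i \<phi> x)"
proof -
  have K: "compact (closure {x. \<phi> x \<noteq> 0})" and C: "C_k 0 \<phi>" "C_k (Suc 0) \<phi>"
    using assms(2) unfolding test_functions_def by blast+
  have cont: "continuous_on UNIV \<phi>" "continuous_on UNIV (partial_deriv i \<phi>)"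
    using C by simp_all
  have "\<phi> x = 0" if "x \<notin> closure {x. \<phi> x \<noteq> 0}" for x
    using that closure_subset[of "{x. \<phi> x \<noteq> 0}"] by blast
  with cont(1) show "integrable lborel (\<lambda>x. u x * \<phi> x)"
    by (rule integrable_mult_locally_integrable[OF assms(1) _ K])
  from cont(2) show "integrable lborel (\<lambda>x. u x * partial_deriv i \<phi> x)"
    by (rule integrable_mult_locally_integrable[OF assms(1) _ K partial_deriv_eq_0])
qed

lemma locally_integrable_add:
  "locally_integrable u \<Longrightarrow> locally_integrable v \<Longrightarrow> locally_integrable (\<lambda>x. u x + v x)"
  unfolding locally_integrable_def by (auto intro: set_integral_add)

lemma locally_integrable_cmult:
  "locally_integrable u \<Longrightarrow> locally_integrable (\<lambda>x. c * u x)"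
  unfolding locally_integrable_def by (auto intro: set_integrable_mult_right)

lemma weak_partial_deriv_add:
  assumes "locally_integrable u" "locally_integrable v"
    and "weak_partial_deriv i u g" "weak_partial_deriv i v h"
  shows "weak_partial_deriv i (\<lambda>x. u x + v x) (\<lambda>x. g x + h x)"
  unfolding weak_partial_deriv_def
proof (intro conjI ballI)
  have gh: "locally_integrable g" "locally_integrable h"
    using assms by (auto simp: weak_partial_deriv_def)
  then show "locally_integrable (\<lambda>x. g x + h x)" by (rule locally_integrable_add)
  fix \<phi> :: "real ^ 'a \<Rightarrow> real" assume \<phi>: "\<phi> \<in> test_functions"
  show "(\<integral>x. (u x + v x) * partial_deriv i \<phi> x \<partial>lborel) = - (\<integral>x. (g x + h x) * \<phi> x \<partial>lborel)"
    using assms gh \<phi> by (simp add: distrib_right integrable_mult_test_function weak_partial_deriv_def)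
qed

lemma weak_partial_deriv_cmult:
  assumes "weak_partial_deriv i u g"
  shows "weak_partial_deriv i (\<lambda>x. c * u x) (\<lambda>x. c * g x)"
  using assms by (auto simp: weak_partial_deriv_def locally_integrable_cmult mult.assoc)

lemma Lp_space_add:
  "p > 1 \<Longrightarrow> f \<in> Lp_space p \<Longrightarrow> g \<in> Lp_space p \<Longrightarrow> (\<lambda>x. f x + g x) \<in> Lp_space p"
  by (auto simp: Lp_space_def intro: integrable_norm_powr_add)

lemma Lp_space_scaleR: "f \<in> Lp_space p \<Longrightarrow> (\<lambda>x. c *\<^sub>R f x) \<in> Lp_space p"
  unfolding Lp_space_def using integrable_norm_powr_scaleR[of lborel f p c]
  by (auto intro: borel_measurable_scaleR simp del: norm_scaleR)

lemma Lp_space_zero: "(\<lambda>_. 0) \<in> Lp_space p"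
  by (simp add: Lp_space_def)

lemma weak_gradient_add:
  assumes "p > 1" "locally_integrable u" "locally_integrable v" "weak_gradient p u G" "weak_gradient p v H"
  shows "weak_gradient p (\<lambda>x. u x + v x) (\<lambda>x. G x + H x)"
  using assms by (auto simp: weak_gradient_def weak_partial_deriv_add Lp_space_add)

lemma weak_gradient_cmult:
  assumes "weak_gradient p u G"
  shows "weak_gradient p (\<lambda>x. c * u x) (\<lambda>x. c *\<^sub>R G x)"
  unfolding weak_gradient_def
proof (intro allI conjI)
  fix i
  have G: "weak_partial_deriv i u (\<lambda>x. G x $ i)" "(\<lambda>x. G x $ i) \<in> Lp_space p"
    using assms by (auto simp: weak_gradient_def)
  show "weak_partial_deriv i (\<lambda>x. c * u x) (\<lambda>x. (c *\<^sub>R G x) $ i)"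
    using weak_partial_deriv_cmult[OF G(1)] by simp
  show "(\<lambda>x. (c *\<^sub>R G x) $ i) \<in> Lp_space p"
    using Lp_space_scaleR[OF G(2), of c] by simp
qed

lemma weak_gradient_zero: "weak_gradient p (\<lambda>_. 0) (\<lambda>_. 0)"
  by (simp add: weak_gradient_def weak_partial_deriv_def locally_integrable_def set_integrable_def Lp_space_zero)

lemma hoelder_continuous_add:
  fixes u v :: "'a::metric_space \<Rightarrow> 'b::real_normed_vector"
  assumes "hoelder_continuous \<alpha> u" "hoelder_continuous \<alpha> v"
  shows "hoelder_continuous \<alpha> (\<lambda>x. u x + v x)"
proof -
  obtain C D where "\<And>x y. dist (u x) (u y) \<le> C * dist x y powr \<alpha>"
    "\<And>x y. dist (v x) (v y) \<le> D * dist x y powr \<alpha>"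
    using assms unfolding hoelder_continuous_def by blast
  then have "dist (u x + v x) (u y + v y) \<le> (C + D) * dist x y powr \<alpha>" for x y
    unfolding distrib_right by (intro order_trans[OF dist_triangle_add] add_mono)
  then show ?thesis unfolding hoelder_continuous_def by blast
qed

lemma hoelder_continuous_cmult:
  fixes u :: "'a::metric_space \<Rightarrow> real"
  assumes "hoelder_continuous \<alpha> u"
  shows "hoelder_continuous \<alpha> (\<lambda>x. c * u x)"
proof -
  obtain C where C: "\<And>x y. dist (u x) (u y) \<le> C * dist x y powr \<alpha>"
    using assms unfolding hoelder_continuous_def by blast
  have "dist (c * u x) (c * u y) = \<bar>c\<bar> * dist (u x) (u y)" for x y
    unfolding dist_real_def right_diff_distrib[symmetric] abs_mult ..
  then have "dist (c * u x) (c * u y) \<le> (\<bar>c\<bar> * C) * dist x y powr \<alpha>" for x y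
    unfolding mult.assoc using C by (auto intro: mult_left_mono)
  then show ?thesis unfolding hoelder_continuous_def by blast
qed

lemma D1p_locally_integrable: "u \<in> D1p p \<Longrightarrow> locally_integrable u"
  by (simp add: D1p_def)

lemma D1p_zero: "(\<lambda>_ :: real ^ 'n::finite. 0) \<in> D1p p"
proof -
  have "hoelder_continuous \<alpha> (\<lambda>_ :: real ^ 'n. 0 :: real)" for \<alpha>
    unfolding hoelder_continuous_def by (rule exI[of _ 0]) simp
  moreover have "locally_integrable (\<lambda>_ :: real ^ 'n. 0)"
    by (simp add: locally_integrable_def set_integrable_def)
  ultimately show ?thesis unfolding D1p_def using weak_gradient_zero by blast
qed

lemma D1p_add: "p > 1 \<Longrightarrow> u \<in> D1p p \<Longrightarrow> v \<in> D1p p \<Longrightarrow> (\<lambda>x. u x + v x) \<in> D1p p"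
  unfolding D1p_def
  using locally_integrable_add hoelder_continuous_add weak_gradient_add by blast

lemma D1p_cmult: "u \<in> D1p p \<Longrightarrow> (\<lambda>x. c * u x) \<in> D1p p"
  unfolding D1p_def
  using locally_integrable_cmult hoelder_continuous_cmult weak_gradient_cmult by blast

text \<open>\<open>weak_gradient\<close> speaks of components only; the field is reassembled from
  them by the basis expansion, one index at a time.\<close>

lemma weak_gradient_in_Lp_space:
  fixes G :: "real ^ 'n::finite \<Rightarrow> real ^ 'n"
  assumes "p > 1" "weak_gradient p u G"
  shows "G \<in> Lp_space p"
proof -
  have "(\<lambda>x. \<Sum>i\<in>I. (G x $ i) *\<^sub>R (axis i 1 :: real ^ 'n)) \<in> Lp_space p" if "finite I" for I
    using that
  proof (induction I)
    case (insert i I)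
    have "(\<lambda>x. G x $ i) \<in> Lp_space p" using assms(2) by (simp add: weak_gradient_def)
    then have "(\<lambda>x. (G x $ i) *\<^sub>R (axis i 1 :: real ^ 'n)) \<in> Lp_space p"
      unfolding Lp_space_def by (auto intro: borel_measurable_scaleR)
    then show ?case using insert Lp_space_add[OF assms(1)] by simp
  qed (simp add: Lp_space_zero)
  then have "(\<lambda>x. \<Sum>i\<in>UNIV. (G x $ i) *\<^sub>R (axis i 1 :: real ^ 'n)) \<in> Lp_space p" by simp
  moreover have "(\<lambda>x. \<Sum>i\<in>UNIV. (G x $ i) *\<^sub>R (axis i 1 :: real ^ 'n)) = G"
    using basis_expansion[of "G _"] by (simp add: scalar_mult_eq_scaleR)
  ultimately show ?thesis by simp
qed

section \<open>The duality theorem\<close>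

theorem proposition6p3:
  fixes p q :: real and \<rho> :: "(real ^ 'n::finite) set \<Rightarrow> real"
  assumes "real CARD('n) < p"
    and "1 / p + 1 / q = 1"
    and "signed_borel_measure \<rho>"
    and "compact (signed_support \<rho>)"
    and "\<rho> UNIV = 0"
    and "signed_integral \<rho> (\<lambda>y. y) \<noteq> 0"
  shows "(SUP u \<in> {u \<in> D1p p. \<exists>Du. weak_gradient p u Du \<and> Lp_norm p Du \<le> 1}.
            ereal \<bar>signed_integral \<rho> u\<bar>) =
         (INF F \<in> {F \<in> Lp_space q. div_eq p F \<rho>}. ereal (Lp_norm q F))"
proof -
  have p: "p > 1"
  proof -
    have "real CARD('n) \<ge> 1" by (simp add: Suc_le_eq)
    then show ?thesis using assms(1) by linarith
  qed
  have q: "q > 1"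
  proof -
    have "0 < 1 / p" "1 / p < 1" using p by simp_all
    then have "0 < 1 / q" "1 / q < 1" using assms(2) by linarith+
    then show ?thesis by (simp add: divide_less_eq_1)
  qed
  note pq = p q assms(2)
  define L :: "(real ^ 'n \<Rightarrow> real) \<Rightarrow> real" where "L = signed_integral \<rho>"
  define S :: "(real ^ 'n \<Rightarrow> real) set" where "S = {u \<in> D1p p. \<exists>Du. weak_gradient p u Du \<and> Lp_norm p Du \<le> 1}"
  define \<F> where "\<F> = {F :: real ^ 'n \<Rightarrow> real ^ 'n. F \<in> Lp_space q \<and> div_eq p F \<rho>}"
  have L_add: "L (\<lambda>x. u x + v x) = L u + L v" if "u \<in> D1p p" "v \<in> D1p p" for u v
    unfolding L_def using that assms(1) by (intro signed_integral_add assms(3,4) D1p_continuous)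
  have L_cmult: "L (\<lambda>x. c * u x) = c * L u" for c u
    unfolding L_def by (rule signed_integral_cmult)
  have Lp_norm_scaleR: "Lp_norm p (\<lambda>x. c *\<^sub>R G x) = \<bar>c\<bar> * Lp_norm p G"
    for c and G :: "real ^ 'n \<Rightarrow> real ^ 'n"
  proof -
    have "(\<integral>x. norm (c *\<^sub>R G x) powr p \<partial>lborel) = \<bar>c\<bar> powr p * (\<integral>x. norm (G x) powr p \<partial>lborel)"
      by (simp only: norm_scaleR_powr integral_mult_right_zero)
    then show ?thesis using p by (simp add: Lp_norm_def powr_mult powr_powr)
  qed
  have norm_nonneg: "Lp_norm p G \<ge> 0" for G :: "real ^ 'n \<Rightarrow> real ^ 'n"
    by (simp add: Lp_norm_def)

  have weak_duality: "\<bar>L u\<bar> \<le> Lp_norm q F" if "u \<in> S" "F \<in> \<F>" for u F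
  proof -
    obtain G where G: "u \<in> D1p p" "weak_gradient p u G" "Lp_norm p G \<le> 1"
      using \<open>u \<in> S\<close> by (auto simp: S_def)
    have F: "F \<in> Lp_space q" "div_eq p F \<rho>" using \<open>F \<in> \<F>\<close> by (auto simp: \<F>_def)
    have "L u = - (\<integral>y. G y \<bullet> F y \<partial>lborel)"
      using F(2) G(1,2) by (simp add: div_eq_def L_def)
    then have "\<bar>L u\<bar> = \<bar>\<integral>y. G y \<bullet> F y \<partial>lborel\<bar>" by simp
    also have "\<dots> \<le> Lp_norm p G * Lp_norm q F"
      using weak_gradient_in_Lp_space[OF p G(2)] F(1) unfolding Lp_norm_def Lp_space_def
      by (intro Hoelder_inner pq) auto
    also have "\<dots> \<le> 1 * Lp_norm q F"
      using G(3) by (intro mult_right_mono) (auto simp: Lp_norm_def)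
    finally show ?thesis by simp
  qed
  have "(SUP u \<in> S. ereal \<bar>L u\<bar>) = (INF F \<in> \<F>. ereal (Lp_norm q F))"
  proof (rule antisym)
    show "(SUP u \<in> S. ereal \<bar>L u\<bar>) \<le> (INF F \<in> \<F>. ereal (Lp_norm q F))"
      using weak_duality by (intro SUP_least INF_greatest) simp
  next
    \<comment> \<open>The zero function is admissible, which excludes the value
      \<open>-\<infinity>\<close> of an empty supremum and later gives
      \<open>K \<ge> 0\<close>.\<close>
    have "Lp_norm p (\<lambda>_ :: real ^ 'n. 0 :: real ^ 'n) \<le> 1" by (simp add: Lp_norm_def)
    then have "(\<lambda>_. 0) \<in> S"
      unfolding S_def using D1p_zero weak_gradient_zero by blast
    then have "ereal \<bar>L (\<lambda>_. 0)\<bar> \<le> (SUP u \<in> S. ereal \<bar>L u\<bar>)" by (rule SUP_upper)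
    moreover have "L (\<lambda>_. 0) = 0" using L_cmult[of 0] by simp
    ultimately have sup_nonneg: "0 \<le> (SUP u \<in> S. ereal \<bar>L u\<bar>)" by (simp add: zero_ereal_def)
    show "(INF F \<in> \<F>. ereal (Lp_norm q F)) \<le> (SUP u \<in> S. ereal \<bar>L u\<bar>)"
    proof (cases "(SUP u \<in> S. ereal \<bar>L u\<bar>)")
      case PInf
      then show ?thesis by simp
    next
      case MInf
      then show ?thesis using sup_nonneg by simp
    next
      case (real K)
      have K: "K \<ge> 0" using sup_nonneg unfolding real by simp
      have L_le_K: "\<bar>L u\<bar> \<le> K" if "u \<in> S" for u
        using SUP_upper[OF that, of "\<lambda>u. ereal \<bar>L u\<bar>"] unfolding real by simp
      have bound: "\<bar>L u\<bar> \<le> K * Lp_norm p G" if u: "u \<in> D1p p" and G: "weak_gradient p u G" for u G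
      proof -
        \<comment> \<open>Scaling by a general \<open>c\<close> covers both cases below:
          \<open>c = 1 / Lp_norm p G\<close> for positive norm, while for norm \<open>0\<close>
          every \<open>c\<close> is allowed and \<open>c = (K + 1) / \<bar>L u\<bar>\<close> gives
          the contradiction \<open>K + 1 \<le> K\<close>.\<close>
        have scaled: "\<bar>c\<bar> * \<bar>L u\<bar> \<le> K" if "\<bar>c\<bar> * Lp_norm p G \<le> 1" for c
        proof -
          have "(\<lambda>x. c * u x) \<in> S"
            using D1p_cmult[OF u] weak_gradient_cmult[OF G] that
            unfolding S_def by (intro CollectI conjI exI[of _ "\<lambda>x. c *\<^sub>R G x"]) (simp_all add: Lp_norm_scaleR)
          from L_le_K[OF this] show ?thesis by (simp add: L_cmult abs_mult)
        qed
        show ?thesis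
        proof (cases "Lp_norm p G = 0")
          case True
          have "L u = 0"
          proof (rule ccontr)
            assume "L u \<noteq> 0"
            then have "\<bar>(K + 1) / \<bar>L u\<bar>\<bar> * \<bar>L u\<bar> = K + 1" using K by simp
            moreover have "\<bar>(K + 1) / \<bar>L u\<bar>\<bar> * \<bar>L u\<bar> \<le> K" using True by (intro scaled) simp
            ultimately show False by simp
          qed
          then show ?thesis using True by simp
        next
          case False
          then have pos: "Lp_norm p G > 0" using norm_nonneg[of G] by simp
          have "\<bar>1 / Lp_norm p G\<bar> * \<bar>L u\<bar> \<le> K" using pos by (intro scaled) simp
          then show ?thesis using pos by (simp add: pos_divide_le_eq)
        qed
      qed
      define W where "W = {G :: real ^ 'n \<Rightarrow> real ^ 'n. \<exists>u \<in> D1p p. weak_gradient p u G}"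
      \<comment> \<open>The minus sign matches the one in \<open>div_eq\<close>; \<open>SOME\<close>
        picks a potential of the field, and \<open>l_eq\<close> shows that the choice does not
        matter.\<close>
      define l where "l = (\<lambda>G. - L (SOME u. u \<in> D1p p \<and> weak_gradient p u G))"
      text \<open>Two potentials of the same field differ by a function of gradient \<open>0\<close>, on which
        \<open>L\<close> vanishes by \<open>bound\<close>.\<close>
      have l_eq: "l G = - L u" if u: "u \<in> D1p p" "weak_gradient p u G" for u G
      proof -
        define v where "v = (SOME u. u \<in> D1p p \<and> weak_gradient p u G)"
        have v: "v \<in> D1p p" "weak_gradient p v G"
          unfolding v_def using someI[of "\<lambda>u. u \<in> D1p p \<and> weak_gradient p u G", OF conjI[OF u]] by blast+
        define w where "w = (\<lambda>x. u x + (-1) * v x)"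
        have "w \<in> D1p p" unfolding w_def by (intro D1p_add D1p_cmult p u v)
        moreover have "weak_gradient p w (\<lambda>x. G x + (-1) *\<^sub>R G x)"
          unfolding w_def
          by (intro weak_gradient_add weak_gradient_cmult p u(2) v(2)
              D1p_locally_integrable[OF u(1)] D1p_locally_integrable[OF D1p_cmult[OF v(1)]])
        ultimately have "\<bar>L w\<bar> \<le> K * Lp_norm p (\<lambda>x. G x + (-1) *\<^sub>R G x)" by (rule bound)
        then have "L w = 0" by (simp add: Lp_norm_def)
        moreover have "L w = L u + (-1) * L v"
          unfolding w_def by (simp only: L_add[OF u(1) D1p_cmult[OF v(1)]] L_cmult)
        ultimately show ?thesis by (simp add: l_def v_def)
      qed
      have W_Lp: "G \<in> Lp_space p" if "G \<in> W" for G
        using that weak_gradient_in_Lp_space[OF p] unfolding W_def by blast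
      obtain F where F: "F \<in> borel_measurable lborel" "integrable lborel (\<lambda>x. norm (F x) powr q)"
        "(\<integral>x. norm (F x) powr q \<partial>lborel) powr (1 / q) \<le> K"
        "\<And>G. G \<in> W \<Longrightarrow> (\<integral>x. F x \<bullet> G x \<partial>lborel) = l G"
      proof (rule Lp_functional_representation[OF pq K, of W lborel l])
        show "G \<in> borel_measurable lborel" "integrable lborel (\<lambda>x. norm (G x) powr p)" if "G \<in> W" for G
          using W_Lp[OF that] by (auto simp: Lp_space_def)
        show "(\<lambda>_. 0) \<in> W" unfolding W_def using D1p_zero weak_gradient_zero by blast
        fix G assume "G \<in> W"
        then obtain u where u: "u \<in> D1p p" "weak_gradient p u G" by (auto simp: W_def)
        show "\<bar>l G\<bar> \<le> K * (\<integral>x. norm (G x) powr p \<partial>lborel) powr (1 / p)"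
          using bound[OF u] by (simp add: l_eq[OF u] Lp_norm_def)
        fix c :: real
        note cu = D1p_cmult[OF u(1), of c] weak_gradient_cmult[OF u(2), of c]
        show "(\<lambda>x. c *\<^sub>R G x) \<in> W" unfolding W_def using cu by blast
        show "l (\<lambda>x. c *\<^sub>R G x) = c * l G" by (simp only: l_eq[OF cu] l_eq[OF u] L_cmult mult_minus_right)
        fix H assume "H \<in> W"
        then obtain v where v: "v \<in> D1p p" "weak_gradient p v H" by (auto simp: W_def)
        have uv: "(\<lambda>x. u x + v x) \<in> D1p p" "weak_gradient p (\<lambda>x. u x + v x) (\<lambda>x. G x + H x)"
          by (intro D1p_add weak_gradient_add p u v
              D1p_locally_integrable[OF u(1)] D1p_locally_integrable[OF v(1)])+
        show "(\<lambda>x. G x + H x) \<in> W" unfolding W_def using uv by blast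
        show "l (\<lambda>x. G x + H x) = l G + l H"
          by (simp add: l_eq[OF uv] l_eq[OF u] l_eq[OF v] L_add[OF u(1) v(1)])
      qed (rule that)
      have "div_eq p F \<rho>"
        unfolding div_eq_def
      proof (intro ballI allI impI)
        fix v :: "real ^ 'n \<Rightarrow> real" and G
        assume v: "v \<in> D1p p" "weak_gradient p v G"
        then have "G \<in> W" by (auto simp: W_def)
        then have "(\<integral>x. F x \<bullet> G x \<partial>lborel) = - L v" using F(4) l_eq[OF v] by simp
        then show "- (\<integral>y. G y \<bullet> F y \<partial>lborel) = signed_integral \<rho> v"
          by (simp add: L_def inner_commute)
      qed
      then have "F \<in> \<F>" using F(1,2) by (simp add: \<F>_def Lp_space_def)
      then have "(INF F \<in> \<F>. ereal (Lp_norm q F)) \<le> ereal (Lp_norm q F)" by (rule INF_lower)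
      also have "\<dots> \<le> ereal K" using F(3) by (simp add: Lp_norm_def)
      finally show ?thesis unfolding real .
    qed
  qed
  then show ?thesis unfolding S_def \<F>_def L_def .
qed

end
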